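(* Let $G=(V,E)$ be an infinite, countable, connected, quasi-transitive graph. Consider either nearest-neighbour Bernoulli bond (edge) percolation or nearest-neighbour Bernoulli site percolation on $G$. Then $p_T=p_H$.
   Context: A graph $G$ is quasi-transitive if its automorphism group $\mathrm{Aut}(G)$ acts on $V$ with finitely many orbits. Bond percolation with parameter $p\in[0,1]$: each edge is independently open with probability $p$ and closed with probability $1-p$; $G(\omega)$ is the subgraph with vertex set $V$ whose edges are the open edges. Site percolation with parameter $p$: each vertex is independently open with probability $p$ and closed with probability $1-p$; $G(\omega)$ is the subgraph of $G$ induced by the open vertices. In both cases $\mathbb{P}_p$ is the corresponding product measure and $\mathbb{E}_p$ its expectation. The cluster $C_x(\omega)$ is the connected component of $G(\omega)$ containing $x$ (in the site model it is empty if $x$ is closed), and $|C_x|$ is its number of vertices (possibly infinite). The critical values are $$p_H:=\sup\{p\in[0,1]:\ \mathbb{P}_p(|C_x|=\infty)=0\},\qquad p_T:=\sup\{p\in[0,1]:\ \mathbb{E}_p(|C_x|)<\infty\}.$$ Neither of them depends on the choice of the vertex $x$. *)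

theory Defs
  imports "HOL-Probability.Probability"
begin

text \<open>
  Simple undirected graphs are given by a vertex set and a set of two-element vertex sets.
  No local finiteness is imposed.
\<close>

definition simple_graph :: "'v set \<Rightarrow> 'v set set \<Rightarrow> bool" where
  "simple_graph V E \<longleftrightarrow> (\<forall>e\<in>E. \<exists>u\<in>V. \<exists>v\<in>V. u \<noteq> v \<and> e = {u, v})"

definition component :: "'v set \<Rightarrow> 'v set set \<Rightarrow> 'v \<Rightarrow> 'v set" where
  "component V E x = {y. x \<in> V \<and> y \<in> V \<and> (x, y) \<in> {(u, v). {u, v} \<in> E}\<^sup>*}"

definition connected_graph :: "'v set \<Rightarrow> 'v set set \<Rightarrow> bool" where
  "connected_graph V E \<longleftrightarrow> V \<noteq> {} \<and> (\<forall>x\<in>V. component V E x = V)"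

text \<open>
  The values of an automorphism outside \<open>V\<close> are left unconstrained; this does not affect the
  orbits of points of \<open>V\<close>.
\<close>

definition graph_automorphism :: "'v set \<Rightarrow> 'v set set \<Rightarrow> ('v \<Rightarrow> 'v) \<Rightarrow> bool" where
  "graph_automorphism V E f \<longleftrightarrow>
     bij_betw f V V \<and> (\<forall>u\<in>V. \<forall>v\<in>V. {f u, f v} \<in> E \<longleftrightarrow> {u, v} \<in> E)"

definition aut_orbit :: "'v set \<Rightarrow> 'v set set \<Rightarrow> 'v \<Rightarrow> 'v set" where
  "aut_orbit V E x = {f x | f. graph_automorphism V E f}"

definition quasi_transitive :: "'v set \<Rightarrow> 'v set set \<Rightarrow> bool" where
  "quasi_transitive V E \<longleftrightarrow> finite (aut_orbit V E ` V)"

definition bernoulli_product :: "'i set \<Rightarrow> real \<Rightarrow> ('i \<Rightarrow> bool) measure" where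
  "bernoulli_product I p = PiM I (\<lambda>_. measure_pmf (bernoulli_pmf p))"

definition bond_cluster :: "'v set \<Rightarrow> 'v set set \<Rightarrow> 'v \<Rightarrow> ('v set \<Rightarrow> bool) \<Rightarrow> 'v set" where
  "bond_cluster V E x \<omega> = component V {e \<in> E. \<omega> e} x"

definition site_cluster :: "'v set \<Rightarrow> 'v set set \<Rightarrow> 'v \<Rightarrow> ('v \<Rightarrow> bool) \<Rightarrow> 'v set" where
  "site_cluster V E x \<omega> = component {v \<in> V. \<omega> v} {e \<in> E. \<forall>v\<in>e. \<omega> v} x"

definition ext_card :: "'a set \<Rightarrow> ennreal" where
  "ext_card A = (if finite A then of_nat (card A) else \<infinity>)"

text \<open>
  The critical values of a family \<open>P p\<close> of probability measures and a random set \<open>C\<close>.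
  For the clusters above, \<open>ext_card \<circ> C\<close> is measurable when \<open>V\<close> is countable, so neither
  \<open>measure\<close> nor the integral falls back on its convention for non-measurable arguments.
\<close>

definition crit_H :: "(real \<Rightarrow> 'c measure) \<Rightarrow> ('c \<Rightarrow> 'v set) \<Rightarrow> real" where
  "crit_H P C =
     Sup {p \<in> {0..1}. measure (P p) {\<omega> \<in> space (P p). ext_card (C \<omega>) = \<infinity>} = 0}"

definition crit_T :: "(real \<Rightarrow> 'c measure) \<Rightarrow> ('c \<Rightarrow> 'v set) \<Rightarrow> real" where
  "crit_T P C = Sup {p \<in> {0..1}. (\<integral>\<^sup>+ \<omega>. ext_card (C \<omega>) \<partial>P p) < \<infinity>}"

definition bond_pH :: "'v set \<Rightarrow> 'v set set \<Rightarrow> 'v \<Rightarrow> real" where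
  "bond_pH V E x = crit_H (bernoulli_product E) (bond_cluster V E x)"

definition bond_pT :: "'v set \<Rightarrow> 'v set set \<Rightarrow> 'v \<Rightarrow> real" where
  "bond_pT V E x = crit_T (bernoulli_product E) (bond_cluster V E x)"

definition site_pH :: "'v set \<Rightarrow> 'v set set \<Rightarrow> 'v \<Rightarrow> real" where
  "site_pH V E x = crit_H (bernoulli_product V) (site_cluster V E x)"

definition site_pT :: "'v set \<Rightarrow> 'v set set \<Rightarrow> 'v \<Rightarrow> real" where
  "site_pT V E x = crit_T (bernoulli_product V) (site_cluster V E x)"

end

theory Submission
  imports Defs
begin

text \<open>
  Why the theorem holds. Every \<open>p\<close> with finite expected cluster size has only finite clusters
  almost surely, so \<open>p\<^sub>T \<le> p\<^sub>H\<close>. The content is the converse inequality in the following form: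
  if the expected size is infinite at \<open>p\<close>, then infinite clusters have positive probability at
  every \<open>p' > p\<close> (\<open>crit_T_eq_crit_H\<close> turns this into equality of the critical values).

  For site percolation on a locally finite graph the argument is the one of Duminil-Copin and
  Tassion. For a finite set \<open>S\<close> containing \<open>x\<close>, let \<open>\<phi>\<^sub>p(x, S)\<close> be the expected number of
  vertices outside \<open>S\<close> that are adjacent to the cluster of \<open>x\<close> inside \<open>S\<close>. There are two cases.

  \<^item> Every vertex \<open>x\<close> has a finite \<open>S\<close> with \<open>\<phi>\<^sub>p(x, S) < 1\<close>. As there are finitely many orbits,
    the sets can be chosen with bounded size and with \<open>\<phi>\<close> bounded away from 1. A cluster consists
    of at most \<open>|S|\<close> vertices in \<open>S\<close> and of the clusters of the vertices where it leaves \<open>S\<close>. Each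
    of the latter is, given the exploration inside \<open>S\<close>, at most as large on average as a fresh
    cluster. So the maximal expected size \<open>\<chi>\<close> satisfies \<open>\<chi> \<le> |S| + (1 - \<delta>) \<chi>\<close>, and is bounded
    (\<open>chi_step\<close>, \<open>chi_bound\<close>).
  \<^item> Some vertex \<open>x\<close> has \<open>\<phi>\<^sub>p(x, S) \<ge> 1\<close> for all \<open>S\<close>, at \<open>p\<close> and hence at every larger
    parameter. Let \<open>f(q)\<close> be the probability that \<open>x\<close> is connected to the boundary of a finite
    set. If it is not, explore everything that is connected to the boundary. The unexplored
    vertices form a set \<open>S\<close>, and the vertices counted in \<open>\<phi>\<^sub>q(x, S)\<close> are pivotal.
    Russo's formula gives \<open>f' \<ge> 1 - f\<close> on \<open>[p, p']\<close>, so \<open>f(p')\<close> is bounded below independently of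
    the finite set (\<open>hit_derivative\<close>, \<open>hit_lower_bound\<close>).

  If some vertex has infinite degree, its cluster is infinite with positive probability as soon as
  \<open>p > 0\<close>. In all cases connectedness carries positive probability from one vertex to every other
  (\<open>percolates_connected\<close>).

  Bond percolation on \<open>G\<close> is site percolation on the line graph of \<open>G\<close>, which is again connected,
  and has finitely many orbits if \<open>G\<close> is locally finite and has finitely many orbits. A bond
  cluster of \<open>x\<close> is infinite iff some edge at \<open>x\<close> has an infinite cluster in the line graph, and its
  size is at most one plus twice the number of its edges (\<open>infinite_bond_cluster_iff\<close>,
  \<open>ext_card_bond_cluster_le\<close>).

  All probabilistic arguments are carried out for finitely many vertices, where expectations are
  finite sums that are polynomial in \<open>p\<close>. The infinite product measure enters only through events
  that depend on finitely many coordinates and through monotone limits of them.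
\<close>

section \<open>Bernoulli expectations over finitely many coordinates\<close>

text \<open>
  A configuration is the set of its open coordinates. Writing the expectation as an explicit sum
  makes it a polynomial in \<open>p\<close>, which can be differentiated, and the recursion \<open>bexp_insert\<close>
  (condition on one coordinate) proves everything below by induction on \<open>J\<close>.
\<close>
definition bexp :: "real \<Rightarrow> 'a set \<Rightarrow> ('a set \<Rightarrow> real) \<Rightarrow> real" where
  "bexp p J g = (\<Sum>\<omega>\<in>Pow J. p ^ card \<omega> * (1 - p) ^ card (J - \<omega>) * g \<omega>)"

lemma bexp_empty [simp]: "bexp p {} g = g {}"
  by (simp add: bexp_def)

lemma bexp_insert:
  assumes "finite J" "e \<notin> J"
  shows "bexp p (insert e J) g = p * bexp p J (\<lambda>\<omega>. g (insert e \<omega>)) + (1 - p) * bexp p J g"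
proof -
  have fin: "finite \<omega>" "e \<notin> \<omega>" "finite (J - \<omega>)" if "\<omega> \<in> Pow J" for \<omega>
    using assms that by (auto intro: finite_subset)
  have inj: "inj_on (insert e) (Pow J)"
    using assms(2) by (auto simp: inj_on_def)
  have disj: "Pow J \<inter> insert e ` Pow J = {}"
    using assms(2) by auto
  have "bexp p (insert e J) g
      = (\<Sum>\<omega>\<in>Pow J. p ^ card \<omega> * (1 - p) ^ card (insert e J - \<omega>) * g \<omega>)
        + (\<Sum>\<omega>\<in>Pow J. p ^ card (insert e \<omega>) * (1 - p) ^ card (insert e J - insert e \<omega>) * g (insert e \<omega>))"
    using assms(1) by (simp add: bexp_def Pow_insert sum.union_disjoint disj sum.reindex inj)
  also have "(\<Sum>\<omega>\<in>Pow J. p ^ card \<omega> * (1 - p) ^ card (insert e J - \<omega>) * g \<omega>) = (1 - p) * bexp p J g"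
    unfolding bexp_def sum_distrib_left
  proof (rule sum.cong)
    fix \<omega> assume "\<omega> \<in> Pow J"
    then have "insert e J - \<omega> = insert e (J - \<omega>)" "e \<notin> J - \<omega>"
      using fin[of \<omega>] assms(2) by auto
    then show "p ^ card \<omega> * (1 - p) ^ card (insert e J - \<omega>) * g \<omega>
        = (1 - p) * (p ^ card \<omega> * (1 - p) ^ card (J - \<omega>) * g \<omega>)"
      using fin[OF \<open>\<omega> \<in> Pow J\<close>] by simp
  qed simp
  also have "(\<Sum>\<omega>\<in>Pow J. p ^ card (insert e \<omega>) * (1 - p) ^ card (insert e J - insert e \<omega>) * g (insert e \<omega>))
      = p * bexp p J (\<lambda>\<omega>. g (insert e \<omega>))"
    unfolding bexp_def sum_distrib_left
  proof (rule sum.cong)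
    fix \<omega> assume "\<omega> \<in> Pow J"
    then have "insert e J - insert e \<omega> = J - \<omega>"
      using assms(2) by auto
    then show "p ^ card (insert e \<omega>) * (1 - p) ^ card (insert e J - insert e \<omega>) * g (insert e \<omega>)
        = p * (p ^ card \<omega> * (1 - p) ^ card (J - \<omega>) * g (insert e \<omega>))"
      using fin[OF \<open>\<omega> \<in> Pow J\<close>] by simp
  qed simp
  finally show ?thesis by simp
qed

lemma bexp_cong: "(\<And>\<omega>. \<omega> \<subseteq> J \<Longrightarrow> g \<omega> = h \<omega>) \<Longrightarrow> bexp p J g = bexp p J h"
  by (simp add: bexp_def)

lemma bexp_mono:
  assumes "0 \<le> p" "p \<le> 1" "\<And>\<omega>. \<omega> \<subseteq> J \<Longrightarrow> g \<omega> \<le> h \<omega>"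
  shows "bexp p J g \<le> bexp p J h"
  using assms by (auto simp: bexp_def intro!: sum_mono mult_left_mono)

lemma bexp_add: "bexp p J (\<lambda>\<omega>. g \<omega> + h \<omega>) = bexp p J g + bexp p J h"
  by (simp add: bexp_def sum.distrib algebra_simps)

lemma bexp_cmult: "bexp p J (\<lambda>\<omega>. c * g \<omega>) = c * bexp p J g"
  by (simp add: bexp_def sum_distrib_left algebra_simps)

lemma bexp_sum: "bexp p J (\<lambda>\<omega>. \<Sum>i\<in>I. g i \<omega>) = (\<Sum>i\<in>I. bexp p J (g i))"
  unfolding bexp_def sum_distrib_left by (rule sum.swap)

lemma bexp_const [simp]: "finite J \<Longrightarrow> bexp p J (\<lambda>_. c) = c"
  by (induction J rule: finite_induct) (auto simp: bexp_insert algebra_simps)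

lemma bexp_nonneg:
  assumes "0 \<le> p" "p \<le> 1" "\<And>\<omega>. \<omega> \<subseteq> J \<Longrightarrow> 0 \<le> g \<omega>"
  shows "0 \<le> bexp p J g"
  using assms by (auto simp: bexp_def intro!: sum_nonneg mult_nonneg_nonneg)

lemma bexp_Un:
  assumes "finite J" "finite K" "J \<inter> K = {}"
  shows "bexp p (J \<union> K) g = bexp p J (\<lambda>a. bexp p K (\<lambda>b. g (a \<union> b)))"
  using assms(1,3)
proof (induction J arbitrary: g rule: finite_induct)
  case (insert e J)
  then have "e \<notin> J \<union> K" "finite (J \<union> K)" using assms(2) by auto
  then show ?case using insert by (simp add: bexp_insert)
qed simp

lemma bexp_split:
  assumes "finite J" "K \<subseteq> J"
  shows "bexp p J g = bexp p K (\<lambda>a. bexp p (J - K) (\<lambda>b. g (a \<union> b)))"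
proof -
  have "J = K \<union> (J - K)" using assms by auto
  then show ?thesis
    using bexp_Un[of K "J - K" p g] assms finite_subset[of K J] by auto
qed

lemma bexp_local:
  assumes "finite J" "K \<subseteq> J"
  shows "bexp p J (\<lambda>\<omega>. g (\<omega> \<inter> K)) = bexp p K g"
proof -
  have "bexp p J (\<lambda>\<omega>. g (\<omega> \<inter> K)) = bexp p K (\<lambda>a. bexp p (J - K) (\<lambda>b. g ((a \<union> b) \<inter> K)))"
    by (rule bexp_split[OF assms])
  also have "\<dots> = bexp p K (\<lambda>a. bexp p (J - K) (\<lambda>b. g a))"
    by (intro bexp_cong arg_cong[where f = g]) auto
  finally show ?thesis using assms by simp
qed

lemma bexp_indep:
  assumes "finite J"
  shows "bexp p J (\<lambda>\<omega>. g (\<omega> \<inter> X) * h (\<omega> - X)) = bexp p J (\<lambda>\<omega>. g (\<omega> \<inter> X)) * bexp p J (\<lambda>\<omega>. h (\<omega> - X))"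
proof -
  let ?K = "J \<inter> X"
  have "bexp p J (\<lambda>\<omega>. g (\<omega> \<inter> X) * h (\<omega> - X))
      = bexp p ?K (\<lambda>a. bexp p (J - ?K) (\<lambda>b. g ((a \<union> b) \<inter> X) * h ((a \<union> b) - X)))"
    by (rule bexp_split) (use assms in auto)
  also have "\<dots> = bexp p ?K (\<lambda>a. bexp p (J - ?K) (\<lambda>b. g a * h b))"
    by (intro bexp_cong arg_cong2[where f = "(*)"] arg_cong[where f = g] arg_cong[where f = h]) auto
  also have "\<dots> = bexp p ?K (\<lambda>a. bexp p (J - ?K) h * g a)"
    by (simp add: bexp_cmult mult.commute)
  also have "\<dots> = bexp p ?K g * bexp p (J - ?K) h"
    by (simp add: bexp_cmult)
  also have "bexp p ?K g = bexp p J (\<lambda>\<omega>. g (\<omega> \<inter> ?K))"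
    by (rule bexp_local[symmetric]) (use assms in auto)
  also have "\<dots> = bexp p J (\<lambda>\<omega>. g (\<omega> \<inter> X))"
    by (intro bexp_cong arg_cong[where f = g]) auto
  also have "bexp p (J - ?K) h = bexp p J (\<lambda>\<omega>. h (\<omega> \<inter> (J - ?K)))"
    by (rule bexp_local[symmetric]) (use assms in auto)
  also have "\<dots> = bexp p J (\<lambda>\<omega>. h (\<omega> - X))"
    by (intro bexp_cong arg_cong[where f = h]) auto
  finally show ?thesis .
qed

text \<open>
  The strong Markov property of an exploration. \<open>C\<close> is the outcome of exploring \<open>\<omega>\<close>, and the outcome
  is determined by the coordinates \<open>X (C \<omega>)\<close> that it has revealed. Then the coordinates not revealed
  may be replaced by an independent copy: on the event \<open>C \<omega> = K\<close>, which depends on \<open>X K\<close> only, this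
  is independence of disjoint sets of coordinates.
\<close>
lemma bexp_resample:
  assumes J: "finite J"
    and stop: "\<And>\<omega> \<omega>'. \<omega> \<subseteq> J \<Longrightarrow> \<omega>' \<subseteq> J \<Longrightarrow> \<omega> \<inter> X (C \<omega>) = \<omega>' \<inter> X (C \<omega>) \<Longrightarrow> C \<omega>' = C \<omega>"
  shows "bexp p J (\<lambda>\<omega>. h (C \<omega>) (\<omega> - X (C \<omega>)))
       = bexp p J (\<lambda>\<omega>. bexp p J (\<lambda>\<omega>'. h (C \<omega>) (\<omega>' - X (C \<omega>))))"
proof -
  let ?\<K> = "C ` Pow J"
  have fin: "finite ?\<K>" using J by simp
  \<comment> \<open>the indicator of \<open>C \<omega> = K\<close>, written as a function of the revealed part \<open>\<omega> \<inter> X K\<close>\<close>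
  define u where "u K a = (of_bool (\<exists>\<omega>\<subseteq>J. C \<omega> = K \<and> \<omega> \<inter> X K = a) :: real)" for K a
  have u: "u K (\<omega> \<inter> X K) = of_bool (C \<omega> = K)" if "\<omega> \<subseteq> J" for \<omega> K
  proof -
    have "(\<exists>\<omega>'\<subseteq>J. C \<omega>' = K \<and> \<omega>' \<inter> X K = \<omega> \<inter> X K) \<longleftrightarrow> C \<omega> = K"
      using stop that by blast
    then show ?thesis by (simp add: u_def)
  qed
  have split: "bexp p J (\<lambda>\<omega>. G (C \<omega>) \<omega>) = (\<Sum>K\<in>?\<K>. bexp p J (\<lambda>\<omega>. u K (\<omega> \<inter> X K) * G K \<omega>))"
    for G :: "_ \<Rightarrow> _ \<Rightarrow> real"
  proof -
    have "bexp p J (\<lambda>\<omega>. G (C \<omega>) \<omega>) = bexp p J (\<lambda>\<omega>. \<Sum>K\<in>?\<K>. u K (\<omega> \<inter> X K) * G K \<omega>)"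
    proof (rule bexp_cong)
      fix \<omega> assume w: "\<omega> \<subseteq> J"
      have "(\<Sum>K\<in>?\<K>. u K (\<omega> \<inter> X K) * G K \<omega>) = (\<Sum>K\<in>?\<K>. if K = C \<omega> then G K \<omega> else 0)"
        by (rule sum.cong) (auto simp: u[OF w])
      also have "\<dots> = G (C \<omega>) \<omega>"
        using fin w by (simp add: sum.delta)
      finally show "G (C \<omega>) \<omega> = (\<Sum>K\<in>?\<K>. u K (\<omega> \<inter> X K) * G K \<omega>)" by simp
    qed
    then show ?thesis by (simp add: bexp_sum)
  qed
  have "bexp p J (\<lambda>\<omega>. h (C \<omega>) (\<omega> - X (C \<omega>)))
      = (\<Sum>K\<in>?\<K>. bexp p J (\<lambda>\<omega>. u K (\<omega> \<inter> X K)) * bexp p J (\<lambda>\<omega>. h K (\<omega> - X K)))"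
    by (subst split[of "\<lambda>K \<omega>. h K (\<omega> - X K)"]) (simp add: bexp_indep[OF J])
  also have "\<dots> = bexp p J (\<lambda>\<omega>. bexp p J (\<lambda>\<omega>'. h (C \<omega>) (\<omega>' - X (C \<omega>))))"
    by (subst split[of "\<lambda>K \<omega>. bexp p J (\<lambda>\<omega>'. h K (\<omega>' - X K))"])
       (simp add: bexp_cmult[symmetric] mult.commute)
  finally show ?thesis .
qed

lemma bexp_superset:
  assumes "finite K" "J \<subseteq> K" "0 \<le> p" "p \<le> 1"
    and mono: "\<And>a b. a \<subseteq> b \<Longrightarrow> b \<subseteq> K \<Longrightarrow> g a \<le> g b"
  shows "bexp p J g \<le> bexp p K g"
proof -
  have "bexp p J g = bexp p J (\<lambda>a. bexp p (K - J) (\<lambda>b. g a))"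
    using assms by simp
  also have "\<dots> \<le> bexp p J (\<lambda>a. bexp p (K - J) (\<lambda>b. g (a \<union> b)))"
    by (intro bexp_mono assms) (use assms in auto)
  also have "\<dots> = bexp p K g"
    by (rule bexp_split[symmetric]) (use assms in auto)
  finally show ?thesis .
qed

lemma bexp_image:
  assumes "finite J" "inj_on f J"
  shows "bexp p (f ` J) g = bexp p J (\<lambda>\<omega>. g (f ` \<omega>))"
  using assms by (induction J arbitrary: g rule: finite_induct) (auto simp: bexp_insert)

text \<open>
  Russo's formula: increments in a coordinate, summed over the coordinates.
\<close>
lemma bexp_has_derivative:
  assumes "finite J"
  shows "((\<lambda>p. bexp p J g) has_real_derivative
           (\<Sum>e\<in>J. bexp p (J - {e}) (\<lambda>\<omega>. g (insert e \<omega>) - g \<omega>))) (at p)"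
  using assms
proof (induction J arbitrary: g rule: finite_induct)
  case (insert e J)
  define D where "D g = (\<Sum>i\<in>J. bexp p (J - {i}) (\<lambda>\<omega>. g (insert i \<omega>) - g \<omega>))" for g :: "'a set \<Rightarrow> real"
  have IH: "((\<lambda>p. bexp p J g) has_real_derivative D g) (at p)" for g
    unfolding D_def by (rule insert.IH)
  have sub: "bexp p K (\<lambda>\<omega>. g \<omega> - h \<omega>) = bexp p K g - bexp p K h" for K and g h :: "'a set \<Rightarrow> real"
    by (simp add: bexp_def sum_subtractf algebra_simps)
  have "((\<lambda>p. p * bexp p J (\<lambda>\<omega>. g (insert e \<omega>)) + (1 - p) * bexp p J g) has_real_derivative
      (bexp p J (\<lambda>\<omega>. g (insert e \<omega>)) - bexp p J g + (p * D (\<lambda>\<omega>. g (insert e \<omega>)) + (1 - p) * D g))) (at p)"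
    by (auto intro!: derivative_eq_intros IH simp: algebra_simps)
  moreover have "bexp p (insert e J - {i}) (\<lambda>\<omega>. g (insert i \<omega>) - g \<omega>)
      = p * bexp p (J - {i}) (\<lambda>\<omega>. g (insert i (insert e \<omega>)) - g (insert e \<omega>))
        + (1 - p) * bexp p (J - {i}) (\<lambda>\<omega>. g (insert i \<omega>) - g \<omega>)" if "i \<in> J" for i
  proof -
    have "insert e J - {i} = insert e (J - {i})" using insert.hyps that by auto
    then show ?thesis using insert.hyps by (simp add: bexp_insert)
  qed
  moreover have "insert e J - {e} = J" using insert.hyps by auto
  ultimately show ?case
    using insert.hyps
    by (simp add: bexp_insert D_def sub sum.distrib sum_distrib_left insert_commute)
qed simp

lemma bexp_mono_parameter:
  assumes "finite J" "0 \<le> p" "p \<le> q" "q \<le> 1"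
    and mono: "\<And>a b. a \<subseteq> b \<Longrightarrow> b \<subseteq> J \<Longrightarrow> g a \<le> g b"
  shows "bexp p J g \<le> bexp q J g"
proof (rule DERIV_nonneg_imp_nondecreasing[OF assms(3)])
  fix s assume s: "p \<le> s" "s \<le> q"
  have "0 \<le> (\<Sum>e\<in>J. bexp s (J - {e}) (\<lambda>\<omega>. g (insert e \<omega>) - g \<omega>))"
  proof (intro sum_nonneg bexp_nonneg)
    fix e \<omega> assume "e \<in> J" "\<omega> \<subseteq> J - {e}"
    then have "g \<omega> \<le> g (insert e \<omega>)" by (intro mono) auto
    then show "0 \<le> g (insert e \<omega>) - g \<omega>" by simp
  qed (use s assms in auto)
  then show "\<exists>y. ((\<lambda>p. bexp p J g) has_real_derivative y) (at s) \<and> 0 \<le> y"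
    using bexp_has_derivative[OF assms(1)] by blast
qed

text \<open>
  The special case of Harris' inequality in which one of the two increasing functions is the
  indicator that a single coordinate is open.
\<close>
lemma bexp_force_open:
  assumes "finite J" "e \<in> J" "0 \<le> p" "p \<le> 1"
    and mono: "\<And>a b. a \<subseteq> b \<Longrightarrow> b \<subseteq> J \<Longrightarrow> g a \<le> g b"
  shows "p * bexp p J g \<le> bexp p J (\<lambda>\<omega>. of_bool (e \<in> \<omega>) * g \<omega>)"
proof -
  let ?K = "J - {e}"
  have J: "J = insert e ?K" using assms(2) by auto
  have exp: "bexp p J h = p * bexp p ?K (\<lambda>\<omega>. h (insert e \<omega>)) + (1 - p) * bexp p ?K h" for h
    by (subst J, rule bexp_insert) (use assms(1) in auto)
  have le: "bexp p ?K g \<le> bexp p ?K (\<lambda>\<omega>. g (insert e \<omega>))"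
    using assms(2,3,4) by (intro bexp_mono) (auto intro!: mono)
  have "bexp p ?K (\<lambda>\<omega>. of_bool (e \<in> \<omega>) * g \<omega>) = bexp p ?K (\<lambda>\<omega>. 0)"
    by (rule bexp_cong) auto
  then have "bexp p J (\<lambda>\<omega>. of_bool (e \<in> \<omega>) * g \<omega>) = p * bexp p ?K (\<lambda>\<omega>. g (insert e \<omega>))"
    using assms(1) by (subst exp) simp
  moreover have "bexp p J g \<le> bexp p ?K (\<lambda>\<omega>. g (insert e \<omega>))"
    using mult_left_mono[OF le, of "1 - p"] assms(4) by (subst exp) (simp add: algebra_simps)
  ultimately show ?thesis
    using assms(3) by (simp add: mult_left_mono)
qed

text \<open>
  Russo's formula for an increasing event, keeping only the pivotal coordinates that are closed.
  Their expected number differs from the derivative by the factor \<open>1 - p \<le> 1\<close>. In this form the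
  bound is a statement about configurations outside the event, which suits the exploration below.
\<close>
lemma russo_lower_bound:
  assumes "finite J" "0 \<le> p" "p \<le> 1"
    and mono: "\<And>a b. a \<subseteq> b \<Longrightarrow> b \<subseteq> J \<Longrightarrow> A a \<Longrightarrow> A b"
  shows "\<exists>d. ((\<lambda>p. bexp p J (\<lambda>\<omega>. of_bool (A \<omega>))) has_real_derivative d) (at p) \<and>
    bexp p J (\<lambda>\<omega>. if A \<omega> then 0 else real (card {v \<in> J. A (insert v \<omega>)})) \<le> d"
proof (intro exI conjI)
  let ?g = "\<lambda>\<omega>. of_bool (A \<omega>) :: real"
  show "((\<lambda>p. bexp p J ?g) has_real_derivative
      (\<Sum>e\<in>J. bexp p (J - {e}) (\<lambda>\<omega>. ?g (insert e \<omega>) - ?g \<omega>))) (at p)"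
    by (rule bexp_has_derivative[OF assms(1)])
  define P where "P e \<omega> = (of_bool (\<not> A \<omega> \<and> A (insert e \<omega>)) :: real)" for e \<omega>
  have "bexp p J (\<lambda>\<omega>. if A \<omega> then 0 else real (card {v \<in> J. A (insert v \<omega>)}))
      = bexp p J (\<lambda>\<omega>. \<Sum>e\<in>J. P e \<omega>)"
    by (rule bexp_cong) (simp add: P_def sum_of_bool_eq assms(1) Int_def)
  also have "\<dots> = (\<Sum>e\<in>J. bexp p J (P e))"
    by (rule bexp_sum)
  also have "\<dots> \<le> (\<Sum>e\<in>J. bexp p (J - {e}) (\<lambda>\<omega>. ?g (insert e \<omega>) - ?g \<omega>))"
  proof (rule sum_mono)
    fix e assume e: "e \<in> J"
    let ?K = "J - {e}"
    have "bexp p (insert e ?K) (P e) = p * bexp p ?K (\<lambda>\<omega>. P e (insert e \<omega>)) + (1 - p) * bexp p ?K (P e)"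
      by (rule bexp_insert) (use assms(1) in auto)
    moreover have "(\<lambda>\<omega>. P e (insert e \<omega>)) = (\<lambda>_. 0)" by (auto simp: P_def)
    moreover have "insert e ?K = J" using e by auto
    ultimately have "bexp p J (P e) = (1 - p) * bexp p ?K (P e)" using assms(1) by simp
    also have "\<dots> \<le> bexp p ?K (P e)"
      using bexp_nonneg[OF assms(2,3), of ?K "P e"] assms(2) by (simp add: P_def mult_left_le_one_le assms(3))
    also have "\<dots> \<le> bexp p ?K (\<lambda>\<omega>. ?g (insert e \<omega>) - ?g \<omega>)"
      using e by (intro bexp_mono assms) (auto simp: P_def dest: mono[rotated 2])
    finally show "bexp p J (P e) \<le> bexp p ?K (\<lambda>\<omega>. ?g (insert e \<omega>) - ?g \<omega>)" .
  qed
  finally show "bexp p J (\<lambda>\<omega>. if A \<omega> then 0 else real (card {v \<in> J. A (insert v \<omega>)}))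
      \<le> (\<Sum>e\<in>J. bexp p (J - {e}) (\<lambda>\<omega>. ?g (insert e \<omega>) - ?g \<omega>))" .
qed

section \<open>Clusters and their exploration\<close>

text \<open>
  The vertices joined to \<open>D\<close> by a path in \<open>U\<close>. Graphs are given by their adjacency relation, and
  the endpoints of the path have to lie in \<open>U\<close> too: with \<open>U\<close> the set of open vertices, \<open>reach r U {x}\<close>
  is the cluster of \<open>x\<close>, empty if \<open>x\<close> is closed.
\<close>
definition reach :: "('a \<times> 'a) set \<Rightarrow> 'a set \<Rightarrow> 'a set \<Rightarrow> 'a set" where
  "reach r U D = (Restr r U)\<^sup>* `` (D \<inter> U)"

lemma reach_start: "x \<in> D \<Longrightarrow> x \<in> U \<Longrightarrow> x \<in> reach r U D"
  by (auto simp: reach_def)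

lemma reach_induct [consumes 1, case_names start step]:
  assumes "y \<in> reach r U D"
    and start: "\<And>x. x \<in> D \<Longrightarrow> x \<in> U \<Longrightarrow> P x"
    and step: "\<And>y z. y \<in> reach r U D \<Longrightarrow> P y \<Longrightarrow> y \<in> U \<Longrightarrow> (y, z) \<in> r \<Longrightarrow> z \<in> U \<Longrightarrow> P z"
  shows "P y"
proof -
  obtain x where x: "x \<in> D" "x \<in> U" "(x, y) \<in> (Restr r U)\<^sup>*"
    using assms(1) by (auto simp: reach_def)
  from x(3) show ?thesis
  proof (induction rule: rtrancl_induct)
    case base
    show ?case using start x by blast
  next
    case (step y z)
    have "y \<in> reach r U D" using step.hyps(1) x by (auto simp: reach_def)
    then show ?case using assms(3) step by blast
  qed
qed

lemma reach_subset: "reach r U D \<subseteq> U"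
proof
  fix y assume "y \<in> reach r U D"
  then show "y \<in> U" by (induction rule: reach_induct)
qed

lemma reach_step:
  assumes "y \<in> reach r U D" "(y, z) \<in> r" "z \<in> U"
  shows "z \<in> reach r U D"
proof -
  have "y \<in> U" using assms(1) reach_subset by fast
  then have yz: "(y, z) \<in> Restr r U" using assms by blast
  obtain x where x: "x \<in> D \<inter> U" "(x, y) \<in> (Restr r U)\<^sup>*"
    using assms(1) by (auto simp: reach_def)
  show ?thesis unfolding reach_def
    using rtrancl_into_rtrancl[OF x(2) yz] x(1) by blast
qed

lemma reach_least:
  assumes "D \<inter> U \<subseteq> K" "\<And>y z. y \<in> K \<Longrightarrow> (y, z) \<in> r \<Longrightarrow> z \<in> U \<Longrightarrow> z \<in> K"
  shows "reach r U D \<subseteq> K"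
proof
  fix y assume "y \<in> reach r U D"
  then show "y \<in> K" using assms by (induction rule: reach_induct) auto
qed

lemma reach_mono: "U \<subseteq> U' \<Longrightarrow> D \<subseteq> D' \<Longrightarrow> reach r U D \<subseteq> reach r U' D'"
  by (rule reach_least) (blast intro: reach_start reach_step)+

lemma finite_reach: "finite U \<Longrightarrow> finite (reach r U D)"
  by (rule finite_subset[OF reach_subset])

lemma reach_trans: "D' \<subseteq> reach r U D \<Longrightarrow> reach r U D' \<subseteq> reach r U D"
  by (rule reach_least) (blast intro: reach_step)+

lemma reach_sym:
  assumes "sym r" "y \<in> reach r U {x}"
  shows "x \<in> reach r U {y}"
  using assms(2)
proof (induction rule: reach_induct)
  case (step y z)
  have "y \<in> reach r U {z}"
    using step.hyps symD[OF assms(1) step.hyps(3)] by (blast intro: reach_step[OF reach_start])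
  then show ?case using step.IH reach_trans[of "{y}" r U "{z}"] by blast
qed (auto intro: reach_start)

lemma reach_from_set: "y \<in> reach r U D \<Longrightarrow> \<exists>x\<in>D. y \<in> reach r U {x}"
  by (induction rule: reach_induct) (blast intro: reach_start reach_step)+

lemma reach_image:
  assumes f: "inj_on f V" and U: "U \<subseteq> V" and "D \<subseteq> V"
    and hom: "\<And>u v. u \<in> V \<Longrightarrow> v \<in> V \<Longrightarrow> (f u, f v) \<in> r \<longleftrightarrow> (u, v) \<in> r"
  shows "reach r (f ` U) (f ` D) = f ` reach r U D"
proof
  show "reach r (f ` U) (f ` D) \<subseteq> f ` reach r U D"
  proof (rule reach_least)
    show "f ` D \<inter> f ` U \<subseteq> f ` reach r U D"
      using assms by (auto simp: inj_on_image_Int[OF f, symmetric] intro: reach_start)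
  next
    fix y z assume "y \<in> f ` reach r U D" "(y, z) \<in> r" "z \<in> f ` U"
    moreover have "reach r U D \<subseteq> U" by (rule reach_subset)
    ultimately show "z \<in> f ` reach r U D"
      using U hom by (blast intro: reach_step)
  qed
next
  have "f y \<in> reach r (f ` U) (f ` D)" if "y \<in> reach r U D" for y
    using that
  proof (induction rule: reach_induct)
    case (step y z)
    then show ?case using U hom[of y z] by (auto intro: reach_step)
  qed (auto intro: reach_start)
  then show "f ` reach r U D \<subseteq> reach r (f ` U) (f ` D)" by blast
qed

text \<open>
  The vertices whose state is revealed when the cluster \<open>K\<close> of \<open>D\<close> inside \<open>S\<close> is explored: the
  starting points, the cluster, and the closed vertices of \<open>S\<close> next to it.
\<close>
definition explored :: "('a \<times> 'a) set \<Rightarrow> 'a set \<Rightarrow> 'a set \<Rightarrow> 'a set \<Rightarrow> 'a set" where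
  "explored r S D K = D \<union> K \<union> (r `` K \<inter> S)"

lemma reach_determined:
  assumes K: "K = reach r (\<omega> \<inter> S) D"
    and eq: "\<omega> \<inter> explored r S D K = \<omega>' \<inter> explored r S D K"
  shows "reach r (\<omega>' \<inter> S) D = K"
proof
  have mem: "v \<in> \<omega> \<longleftrightarrow> v \<in> \<omega>'" if "v \<in> explored r S D K" for v
    using eq that by blast
  show "reach r (\<omega>' \<inter> S) D \<subseteq> K"
  proof (rule reach_least)
    show "D \<inter> (\<omega>' \<inter> S) \<subseteq> K"
      unfolding K using mem[unfolded K] by (auto simp: explored_def intro: reach_start)
  next
    fix y z assume "y \<in> K" "(y, z) \<in> r" "z \<in> \<omega>' \<inter> S"
    then have "z \<in> \<omega>" using mem[of z] by (auto simp: explored_def)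
    then show "z \<in> K" using \<open>y \<in> K\<close> \<open>(y, z) \<in> r\<close> \<open>z \<in> \<omega>' \<inter> S\<close>
      unfolding K by (blast intro: reach_step)
  qed
  have "y \<in> reach r (\<omega>' \<inter> S) D" if "y \<in> reach r (\<omega> \<inter> S) D" for y
    using that
  proof (induction rule: reach_induct)
    case (start x)
    then show ?case using mem[of x] by (auto simp: explored_def intro: reach_start)
  next
    case (step y z)
    have "z \<in> K" unfolding K using step.hyps by (blast intro: reach_step)
    then have "z \<in> \<omega>' \<inter> S" using step.hyps mem[of z] by (simp add: explored_def)
    then show ?case using step.IH step.hyps(3) by (blast intro: reach_step)
  qed
  then show "K \<subseteq> reach r (\<omega>' \<inter> S) D" unfolding K by blast
qed

text \<open>
  The counterpart for site percolation of the quantity \<open>\<phi>\<^sub>p(S)\<close> of Duminil-Copin and Tassion.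
\<close>
definition phi :: "('a \<times> 'a) set \<Rightarrow> real \<Rightarrow> 'a \<Rightarrow> 'a set \<Rightarrow> real" where
  "phi r p x S = bexp p S (\<lambda>\<omega>. real (card (r `` reach r \<omega> {x} - S)))"

definition chi :: "('a \<times> 'a) set \<Rightarrow> real \<Rightarrow> 'a set \<Rightarrow> 'a \<Rightarrow> real" where
  "chi r p \<Lambda> x = bexp p \<Lambda> (\<lambda>\<omega>. real (card (reach r \<omega> {x})))"

text \<open>
  A path leaving \<open>S\<close> is cut at its last vertex in the cluster \<open>K\<close> of \<open>x\<close> inside \<open>S\<close>. The next vertex
  lies outside \<open>S\<close>, and from there on the path avoids all explored vertices, because an explored open
  vertex belongs to \<open>K\<close>. It may well return to unexplored parts of \<open>S\<close>.
\<close>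
lemma reach_exit:
  fixes r :: "('a \<times> 'a) set" and \<omega> :: "'a set"
  assumes "x \<in> S"
  defines "K \<equiv> reach r (\<omega> \<inter> S) {x}"
  shows "reach r \<omega> {x} \<subseteq> S \<union> (\<Union>z\<in>(r `` K - S) \<inter> \<omega>. reach r (\<omega> - explored r S {x} K) {z})"
proof
  let ?X = "explored r S {x} K"
  have KS: "K \<subseteq> S" unfolding K_def using reach_subset by fast
  then have XS: "?X \<subseteq> S" using assms(1) by (auto simp: explored_def)
  have XK: "v \<in> K" if "v \<in> ?X" "v \<in> \<omega>" for v
    using that assms(1) unfolding explored_def K_def by (blast intro: reach_start reach_step)
  fix y assume "y \<in> reach r \<omega> {x}"
  then have "y \<in> K \<or> (\<exists>z\<in>(r `` K - S) \<inter> \<omega>. y \<in> reach r (\<omega> - ?X) {z})"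
  proof (induction rule: reach_induct)
    case (start y)
    then show ?case using assms(1) by (auto simp: K_def intro: reach_start)
  next
    case (step y w)
    show ?case
    proof (cases "w \<in> K")
      case False
      then have w: "w \<in> \<omega> - ?X" using XK step by blast
      show ?thesis
      proof (cases "y \<in> K")
        case True
        then have "w \<notin> S" using step False unfolding K_def by (blast intro: reach_step)
        then have "w \<in> (r `` K - S) \<inter> \<omega>" using True step by auto
        moreover have "w \<in> reach r (\<omega> - ?X) {w}" using w by (auto intro: reach_start)
        ultimately show ?thesis by blast
      next
        case False
        then show ?thesis using step w by (blast intro: reach_step)
      qed
    qed simp
  qed
  then show "y \<in> S \<union> (\<Union>z\<in>(r `` K - S) \<inter> \<omega>. reach r (\<omega> - ?X) {z})"
    using KS by blast
qed

lemma finite_neighbours: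
  assumes "\<And>v. finite (r `` {v})" "finite K"
  shows "finite (r `` K)"
proof -
  have "r `` K = (\<Union>v\<in>K. r `` {v})" by auto
  then show ?thesis using assms by auto
qed

text \<open>
  The clusters started at the exits of \<open>S\<close> use unexplored vertices only. After resampling these
  (\<open>bexp_resample\<close>) such a cluster is contained in a fresh one, so each exit contributes at most \<open>M\<close>.
  The expected number of exits is at most \<open>\<phi>\<^sub>p(x, S)\<close>.
\<close>
lemma chi_step:
  assumes fin: "finite \<Lambda>" "finite S" "\<And>v. finite (r `` {v})" and "x \<in> S"
    and p: "0 \<le> p" "p \<le> 1"
    and M: "\<And>z. z \<in> \<Lambda> \<Longrightarrow> chi r p \<Lambda> z \<le> M" "0 \<le> M"
  shows "chi r p \<Lambda> x \<le> real (card S) + phi r p x S * M"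
proof -
  define C where "C \<omega> = reach r (\<omega> \<inter> S) {x}" for \<omega>
  define X where "X K = explored r S {x} K" for K
  define Z where "Z K = (r `` K - S) \<inter> \<Lambda>" for K
  define h where "h K a = (\<Sum>z\<in>Z K. real (card (reach r a {z})))" for K a
  define N where "N \<omega> = real (card (r `` reach r (\<omega> \<inter> S) {x} - S))" for \<omega>
  have finZ: "finite (Z K)" for K using fin by (simp add: Z_def)
  have finN: "finite (r `` K)" if "finite K" for K
    by (rule finite_neighbours[OF fin(3) that])
  have "chi r p \<Lambda> x \<le> bexp p \<Lambda> (\<lambda>\<omega>. real (card S) + h (C \<omega>) (\<omega> - X (C \<omega>)))"
    unfolding chi_def
  proof (rule bexp_mono[OF p])
    fix \<omega> assume w: "\<omega> \<subseteq> \<Lambda>"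
    then have finw: "finite \<omega>" using fin finite_subset by blast
    have "reach r \<omega> {x} \<subseteq> S \<union> (\<Union>z\<in>Z (C \<omega>). reach r (\<omega> - X (C \<omega>)) {z})"
      using reach_exit[OF \<open>x \<in> S\<close>, of r \<omega>] w unfolding C_def X_def Z_def by blast
    then have "card (reach r \<omega> {x}) \<le> card (S \<union> (\<Union>z\<in>Z (C \<omega>). reach r (\<omega> - X (C \<omega>)) {z}))"
      using fin finZ finw by (intro card_mono) (auto simp: finite_reach)
    also have "\<dots> \<le> card S + card (\<Union>z\<in>Z (C \<omega>). reach r (\<omega> - X (C \<omega>)) {z})"
      by (rule card_Un_le)
    also have "\<dots> \<le> card S + (\<Sum>z\<in>Z (C \<omega>). card (reach r (\<omega> - X (C \<omega>)) {z}))"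
      by (intro add_left_mono card_UN_le finZ)
    finally show "real (card (reach r \<omega> {x})) \<le> real (card S) + h (C \<omega>) (\<omega> - X (C \<omega>))"
      unfolding h_def by (simp flip: of_nat_sum of_nat_add)
  qed
  also have "\<dots> = real (card S) + bexp p \<Lambda> (\<lambda>\<omega>. h (C \<omega>) (\<omega> - X (C \<omega>)))"
    using fin by (simp add: bexp_add)
  also have "bexp p \<Lambda> (\<lambda>\<omega>. h (C \<omega>) (\<omega> - X (C \<omega>)))
      = bexp p \<Lambda> (\<lambda>\<omega>. bexp p \<Lambda> (\<lambda>\<omega>'. h (C \<omega>) (\<omega>' - X (C \<omega>))))"
    by (rule bexp_resample[OF fin(1)]) (unfold C_def X_def, erule reach_determined[OF refl])
  also have "\<dots> \<le> bexp p \<Lambda> (\<lambda>\<omega>. M * N \<omega>)"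
  proof (rule bexp_mono[OF p])
    fix \<omega> assume w: "\<omega> \<subseteq> \<Lambda>"
    have "bexp p \<Lambda> (\<lambda>\<omega>'. h (C \<omega>) (\<omega>' - X (C \<omega>)))
        = (\<Sum>z\<in>Z (C \<omega>). bexp p \<Lambda> (\<lambda>\<omega>'. real (card (reach r (\<omega>' - X (C \<omega>)) {z}))))"
      unfolding h_def by (rule bexp_sum)
    also have "\<dots> \<le> (\<Sum>z\<in>Z (C \<omega>). chi r p \<Lambda> z)"
      unfolding chi_def
      by (intro sum_mono bexp_mono p of_nat_mono card_mono finite_reach reach_mono)
         (auto intro: finite_subset[OF _ fin(1)])
    also have "\<dots> \<le> (\<Sum>z\<in>Z (C \<omega>). M)"
      by (intro sum_mono M) (auto simp: Z_def)
    also have "\<dots> = M * real (card (Z (C \<omega>)))" by simp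
    also have "\<dots> \<le> M * N \<omega>"
      unfolding N_def C_def Z_def using fin(2)
      by (intro mult_left_mono M of_nat_mono card_mono) (auto intro!: finN finite_reach)
    finally show "bexp p \<Lambda> (\<lambda>\<omega>'. h (C \<omega>) (\<omega>' - X (C \<omega>))) \<le> M * N \<omega>" .
  qed
  also have "\<dots> = M * bexp p \<Lambda> N" by (rule bexp_cmult)
  also have "\<dots> \<le> M * bexp p (\<Lambda> \<union> S) N"
  proof (intro mult_left_mono M bexp_superset p)
    fix a b assume "a \<subseteq> b" "b \<subseteq> \<Lambda> \<union> S"
    then have "r `` reach r (a \<inter> S) {x} - S \<subseteq> r `` reach r (b \<inter> S) {x} - S"
      using reach_mono[of "a \<inter> S" "b \<inter> S" "{x}" "{x}" r] by blast
    then show "N a \<le> N b"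
      unfolding N_def using fin(2) by (intro of_nat_mono card_mono) (auto intro!: finN finite_reach)
  qed (use fin in auto)
  also have "bexp p (\<Lambda> \<union> S) N = phi r p x S"
    unfolding N_def phi_def
    using fin by (intro bexp_local[of "\<Lambda> \<union> S" S p "\<lambda>\<omega>. real (card (r `` reach r \<omega> {x} - S))"]) auto
  finally show ?thesis by (simp add: mult.commute)
qed

text \<open>
  The bound does not depend on \<open>\<Lambda>\<close>. Finiteness of \<open>\<Lambda>\<close> serves to make the maximum \<open>M\<close> of the
  expected cluster sizes finite, so that \<open>M \<le> m + (1 - \<delta>) M\<close> can be solved for \<open>M\<close>.
\<close>
lemma chi_bound:
  assumes fin: "finite \<Lambda>" "\<And>v. finite (r `` {v})" and p: "0 \<le> p" "p \<le> 1" and "0 < \<delta>"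
    and sub: "\<And>x. x \<in> \<Lambda> \<Longrightarrow> \<exists>S. finite S \<and> x \<in> S \<and> card S \<le> m \<and> phi r p x S \<le> 1 - \<delta>"
  shows "chi r p \<Lambda> x \<le> real m / \<delta>"
proof (cases "x \<in> \<Lambda>")
  case True
  define M where "M = Max (chi r p \<Lambda> ` \<Lambda>)"
  have M: "chi r p \<Lambda> z \<le> M" if "z \<in> \<Lambda>" for z
    unfolding M_def using that fin by auto
  have chi0: "0 \<le> chi r p \<Lambda> z" for z
    unfolding chi_def by (rule bexp_nonneg[OF p]) simp
  have M0: "0 \<le> M" using chi0[of x] M[OF True] by linarith
  have "M \<in> chi r p \<Lambda> ` \<Lambda>" unfolding M_def using fin True by (intro Max_in) auto
  then obtain y where y: "y \<in> \<Lambda>" "M = chi r p \<Lambda> y" by blast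
  obtain S where S: "finite S" "y \<in> S" "card S \<le> m" "phi r p y S \<le> 1 - \<delta>"
    using sub[OF y(1)] by blast
  have "M \<le> real (card S) + phi r p y S * M"
    unfolding y(2) by (rule chi_step[OF fin(1) S(1) fin(2) S(2) p]) (use M M0 y in auto)
  also have "\<dots> \<le> real m + (1 - \<delta>) * M"
    using S M0 by (intro add_mono mult_right_mono) auto
  finally have "\<delta> * M \<le> real m" by (simp add: algebra_simps)
  then have "M \<le> real m / \<delta>" using \<open>0 < \<delta>\<close> by (simp add: field_simps)
  then show ?thesis using M[OF True] by linarith
next
  case False
  have "reach r \<omega> {x} = {}" if "\<omega> \<subseteq> \<Lambda>" for \<omega>
    using that False by (auto simp: reach_def)
  then have "chi r p \<Lambda> x = bexp p \<Lambda> (\<lambda>_. 0)"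
    unfolding chi_def by (intro bexp_cong) simp
  then show ?thesis using fin \<open>0 < \<delta>\<close> by simp
qed

text \<open>
  \<open>D\<close> is the inner boundary of \<open>\<Lambda>\<close>. Explore the cluster \<open>K\<close> of \<open>D\<close>, and let \<open>S\<close> be the unexplored
  part of \<open>\<Lambda>\<close>. If \<open>x \<in> S\<close>, every vertex outside \<open>S\<close> next to the cluster of \<open>x\<close> in \<open>S\<close> is explored,
  closed and joined to \<open>D\<close> once it is opened, hence pivotal. There are \<open>\<phi>\<^sub>q(x, S) \<ge> 1\<close> of them on
  average. If \<open>x\<close> is explored and closed, it is pivotal itself.
\<close>
lemma hit_derivative:
  fixes r :: "('a \<times> 'a) set" and \<Lambda> D :: "'a set"
  assumes fin: "finite \<Lambda>" "\<And>v. finite (r `` {v})" and "sym r" and x: "x \<in> \<Lambda>"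
    and q: "0 \<le> q" "q \<le> 1"
    and big: "\<And>S. S \<subseteq> \<Lambda> \<Longrightarrow> x \<in> S \<Longrightarrow> 1 \<le> phi r q x S"
    and D: "D = {u \<in> \<Lambda>. \<not> r `` {u} \<subseteq> \<Lambda>}"
  defines "f \<equiv> \<lambda>q. bexp q \<Lambda> (\<lambda>\<omega>. of_bool (x \<in> reach r \<omega> D))"
  shows "\<exists>d. (f has_real_derivative d) (at q) \<and> 1 - f q \<le> d"
proof -
  define A where "A \<omega> \<longleftrightarrow> x \<in> reach r \<omega> D" for \<omega>
  have monoA: "A b" if "a \<subseteq> b" "A a" for a b
    using that reach_mono[of a b D D r] unfolding A_def by blast
  obtain d where d: "(f has_real_derivative d) (at q)"
    "bexp q \<Lambda> (\<lambda>\<omega>. if A \<omega> then 0 else real (card {v \<in> \<Lambda>. A (insert v \<omega>)})) \<le> d"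
    using russo_lower_bound[OF fin(1) q, of A] monoA unfolding f_def A_def by blast
  define X where "X K = explored r \<Lambda> D K" for K
  define C where "C \<omega> = reach r (\<omega> \<inter> \<Lambda>) D" for \<omega>
  \<comment> \<open>a lower bound for the number of pivotal vertices, as a function of the explored cluster \<open>K\<close>
    and of the unexplored part \<open>a\<close> of the configuration\<close>
  define h where "h K a = (if x \<in> K then 0 else if x \<in> X K then 1
      else real (card (r `` reach r a {x} - (\<Lambda> - X K))))" for K a
  have "1 - f q = bexp q \<Lambda> (\<lambda>\<omega>. 1 - of_bool (A \<omega>))"
    using bexp_add[of q \<Lambda> "\<lambda>\<omega>. 1" "\<lambda>\<omega>. (-1) * of_bool (A \<omega>)"]
      bexp_cmult[of q \<Lambda> "-1" "\<lambda>\<omega>. of_bool (A \<omega>)"] fin(1)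
    unfolding f_def A_def by simp
  also have "\<dots> \<le> bexp q \<Lambda> (\<lambda>\<omega>. bexp q \<Lambda> (\<lambda>\<omega>'. h (C \<omega>) (\<omega>' - X (C \<omega>))))"
  proof (rule bexp_mono[OF q])
    fix \<omega> assume w: "\<omega> \<subseteq> \<Lambda>"
    then have Cw: "C \<omega> = reach r \<omega> D" by (simp add: C_def Int_absorb2)
    let ?K = "C \<omega>"
    consider "x \<in> ?K" | "x \<notin> ?K" "x \<in> X ?K" | "x \<notin> ?K" "x \<notin> X ?K" by blast
    then show "1 - of_bool (A \<omega>) \<le> bexp q \<Lambda> (\<lambda>\<omega>'. h ?K (\<omega>' - X ?K))"
    proof cases
      case 1
      then show ?thesis using Cw fin(1) by (simp add: h_def A_def)
    next
      case 2
      then show ?thesis using fin(1) by (simp add: h_def)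
    next
      case 3
      let ?S = "\<Lambda> - X ?K"
      have "bexp q \<Lambda> (\<lambda>\<omega>'. h ?K (\<omega>' - X ?K))
          = bexp q \<Lambda> (\<lambda>\<omega>'. real (card (r `` reach r (\<omega>' \<inter> ?S) {x} - ?S)))"
      proof (rule bexp_cong)
        fix \<omega>' assume "\<omega>' \<subseteq> \<Lambda>"
        then have "\<omega>' - X ?K = \<omega>' \<inter> ?S" by auto
        then show "h ?K (\<omega>' - X ?K) = real (card (r `` reach r (\<omega>' \<inter> ?S) {x} - ?S))"
          using 3 by (simp add: h_def)
      qed
      also have "\<dots> = phi r q x ?S"
        unfolding phi_def using fin
        by (intro bexp_local[of \<Lambda> ?S q "\<lambda>\<omega>. real (card (r `` reach r \<omega> {x} - ?S))"]) auto
      also have "1 \<le> \<dots>" using 3 x by (intro big) auto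
      finally show ?thesis by simp
    qed
  qed
  also have "\<dots> = bexp q \<Lambda> (\<lambda>\<omega>. h (C \<omega>) (\<omega> - X (C \<omega>)))"
    by (rule bexp_resample[OF fin(1), symmetric]) (unfold C_def X_def, erule reach_determined[OF refl])
  also have "\<dots> \<le> bexp q \<Lambda> (\<lambda>\<omega>. if A \<omega> then 0 else real (card {v \<in> \<Lambda>. A (insert v \<omega>)}))"
  proof (rule bexp_mono[OF q])
    fix \<omega> assume w: "\<omega> \<subseteq> \<Lambda>"
    then have Cw: "C \<omega> = reach r \<omega> D" by (simp add: C_def Int_absorb2)
    let ?K = "C \<omega>"
    \<comment> \<open>opening an explored vertex connects it to \<open>D\<close>\<close>
    have piv: "v \<in> reach r (insert v \<omega>) D" if "v \<in> X ?K" for v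
    proof -
      have "?K \<subseteq> reach r (insert v \<omega>) D" unfolding Cw by (rule reach_mono) auto
      moreover have "v \<in> D \<or> v \<in> ?K \<or> (\<exists>u\<in>?K. (u, v) \<in> r)"
        using that unfolding X_def explored_def by auto
      ultimately show ?thesis by (blast intro: reach_start reach_step)
    qed
    consider "x \<in> ?K" | "x \<notin> ?K" "x \<in> X ?K" | "x \<notin> ?K" "x \<notin> X ?K" by blast
    then show "h ?K (\<omega> - X ?K) \<le> (if A \<omega> then 0 else real (card {v \<in> \<Lambda>. A (insert v \<omega>)}))"
    proof cases
      case 1
      then show ?thesis using Cw by (simp add: h_def A_def)
    next
      case 2
      then have "\<not> A \<omega>" using Cw by (simp add: A_def)
      moreover have "x \<in> {v \<in> \<Lambda>. A (insert v \<omega>)}" using x piv[of x] 2 by (simp add: A_def)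
      moreover from this have "0 < card {v \<in> \<Lambda>. A (insert v \<omega>)}"
        using fin(1) by (subst card_gt_0_iff) auto
      ultimately show ?thesis using 2 by (simp add: h_def)
    next
      case 3
      then have "\<not> A \<omega>" using Cw by (simp add: A_def)
      have "r `` reach r (\<omega> - X ?K) {x} - (\<Lambda> - X ?K) \<subseteq> {v \<in> \<Lambda>. A (insert v \<omega>)}"
      proof
        fix v assume v: "v \<in> r `` reach r (\<omega> - X ?K) {x} - (\<Lambda> - X ?K)"
        then obtain u where u: "u \<in> reach r (\<omega> - X ?K) {x}" "(u, v) \<in> r" by blast
        have uX: "u \<in> \<omega>" "u \<notin> X ?K" using u(1) reach_subset by fast+
        then have "u \<in> \<Lambda>" "u \<notin> D" using w by (auto simp: X_def explored_def)
        \<comment> \<open>the unexplored \<open>u\<close> is not on the inner boundary, so its neighbours lie in \<open>\<Lambda>\<close>\<close>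
        then have vL: "v \<in> \<Lambda>" using u(2) D by auto
        then have vX: "v \<in> X ?K" using v by blast
        have "u \<in> reach r (insert v \<omega>) D"
          using piv[OF vX] symD[OF \<open>sym r\<close> u(2)] uX(1) by (blast intro: reach_step)
        moreover have "u \<in> reach r (insert v \<omega>) {x}"
          using u(1) reach_mono[of "\<omega> - X ?K" "insert v \<omega>" "{x}" "{x}" r] by auto
        then have "x \<in> reach r (insert v \<omega>) {u}" by (rule reach_sym[OF \<open>sym r\<close>])
        ultimately have "x \<in> reach r (insert v \<omega>) D"
          using reach_trans[of "{u}" r "insert v \<omega>" D] by blast
        then show "v \<in> {v \<in> \<Lambda>. A (insert v \<omega>)}" using vL by (simp add: A_def)
      qed
      then have "card (r `` reach r (\<omega> - X ?K) {x} - (\<Lambda> - X ?K)) \<le> card {v \<in> \<Lambda>. A (insert v \<omega>)}"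
        using fin(1) by (intro card_mono) auto
      then show ?thesis using 3 \<open>\<not> A \<omega>\<close> by (simp add: h_def)
    qed
  qed
  also have "\<dots> \<le> d" by (rule d(2))
  finally show ?thesis using d(1) by blast
qed

lemma phi_mono_parameter:
  assumes "finite S" "\<And>v. finite (r `` {v})" "0 \<le> p" "p \<le> q" "q \<le> 1"
  shows "phi r p x S \<le> phi r q x S"
  unfolding phi_def
proof (rule bexp_mono_parameter[OF assms(1,3,4,5)])
  fix a b assume ab: "a \<subseteq> b" "b \<subseteq> S"
  then have "r `` reach r a {x} - S \<subseteq> r `` reach r b {x} - S"
    using reach_mono[of a b "{x}" "{x}" r] by blast
  then show "real (card (r `` reach r a {x} - S)) \<le> real (card (r `` reach r b {x} - S))"
    using finite_neighbours[of r, OF assms(2) finite_reach[OF finite_subset[OF ab(2) assms(1)]]]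
    by (intro of_nat_mono card_mono finite_Diff)
qed

text \<open>
  On \<open>[p, p']\<close> the derivative of the increasing function \<open>f\<close> is at least \<open>1 - f \<ge> 1 - f(p')\<close>. By the
  mean value theorem \<open>f(p') \<ge> (p' - p) (1 - f(p'))\<close>, and this is solved for \<open>f(p')\<close>.
\<close>
lemma hit_lower_bound:
  assumes fin: "finite \<Lambda>" "\<And>v. finite (r `` {v})" and "sym r" and x: "x \<in> \<Lambda>"
    and p: "0 \<le> p" "p < p'" "p' \<le> 1"
    and big: "\<And>S. S \<subseteq> \<Lambda> \<Longrightarrow> x \<in> S \<Longrightarrow> 1 \<le> phi r p x S"
    and D: "D = {u \<in> \<Lambda>. \<not> r `` {u} \<subseteq> \<Lambda>}"
  shows "(p' - p) / (1 + (p' - p)) \<le> bexp p' \<Lambda> (\<lambda>\<omega>. of_bool (x \<in> reach r \<omega> D))"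
proof -
  define f where "f q = bexp q \<Lambda> (\<lambda>\<omega>. of_bool (x \<in> reach r \<omega> D) :: real)" for q
  have deriv: "\<exists>d. (f has_real_derivative d) (at q) \<and> 1 - f q \<le> d" if q: "p \<le> q" "q \<le> p'" for q
  proof -
    have "1 \<le> phi r q x S" if "S \<subseteq> \<Lambda>" "x \<in> S" for S
      using big[OF that] phi_mono_parameter[of S r p q x] fin that q p
      by (meson finite_subset order_trans)
    then show ?thesis
      unfolding f_def using q p fin(2) by (intro hit_derivative[OF fin(1) _ \<open>sym r\<close> x _ _ _ D]) auto
  qed
  have mono: "f q \<le> f p'" if "p \<le> q" "q \<le> p'" for q
    unfolding f_def
  proof (intro bexp_mono_parameter fin)
    fix a b assume "a \<subseteq> b" "b \<subseteq> \<Lambda>"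
    then have "reach r a D \<subseteq> reach r b D" by (intro reach_mono) auto
    then show "(of_bool (x \<in> reach r a D) :: real) \<le> of_bool (x \<in> reach r b D)" by auto
  qed (use that p in auto)
  obtain d where d: "\<And>q. p \<le> q \<Longrightarrow> q \<le> p' \<Longrightarrow> (f has_real_derivative d q) (at q) \<and> 1 - f q \<le> d q"
    using deriv by metis
  obtain z where z: "p < z" "z < p'" "f p' - f p = (p' - p) * d z"
    using MVT2[OF p(2), of f d] d by blast
  have "0 \<le> f p" unfolding f_def using p by (intro bexp_nonneg) auto
  moreover have "1 - f p' \<le> d z" using d[of z] mono[of z] z by force
  then have "(p' - p) * (1 - f p') \<le> (p' - p) * d z"
    using p by (intro mult_left_mono) auto
  ultimately have "(p' - p) * (1 - f p') \<le> f p'" using z by linarith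
  then have "(p' - p) / (1 + (p' - p)) \<le> f p'"
    using p by (simp add: field_simps)
  then show ?thesis by (simp add: f_def)
qed

section \<open>Percolation at one vertex implies percolation at all vertices\<close>

text \<open>
  A finite-volume form of ``the cluster of \<open>x\<close> is infinite with probability at least \<open>c\<close>'': it leaves
  every finite \<open>F\<close> with at least this probability.
\<close>
definition percolates :: "'a set \<Rightarrow> ('a \<times> 'a) set \<Rightarrow> real \<Rightarrow> 'a \<Rightarrow> real \<Rightarrow> bool" where
  "percolates V r p x c \<longleftrightarrow> (\<forall>F. finite F \<longrightarrow>
     (\<exists>\<Lambda>\<subseteq>V. finite \<Lambda> \<and> c \<le> bexp p \<Lambda> (\<lambda>\<omega>. of_bool (\<not> reach r \<omega> {x} \<subseteq> F))))"

lemma not_reach_subset_mono: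
  assumes "a \<subseteq> b"
  shows "(of_bool (\<not> reach r a D \<subseteq> F) :: real) \<le> of_bool (\<not> reach r b D \<subseteq> F)"
proof -
  have "reach r a D \<subseteq> reach r b D" using assms by (intro reach_mono) simp_all
  then have "\<not> reach r a D \<subseteq> F \<longrightarrow> \<not> reach r b D \<subseteq> F" by blast
  then show ?thesis by simp
qed

text \<open>
  If \<open>\<Lambda>\<close> contains \<open>F\<close> and its neighbours, the inner boundary of \<open>\<Lambda>\<close> avoids \<open>F\<close>. A cluster that
  reaches this boundary therefore leaves \<open>F\<close>.
\<close>
lemma percolates_if_phi_ge_1:
  assumes r: "r \<subseteq> V \<times> V" "sym r" "\<And>v. finite (r `` {v})" and x: "x \<in> V"
    and p: "0 \<le> p" "p < p'" "p' \<le> 1"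
    and big: "\<And>S. S \<subseteq> V \<Longrightarrow> finite S \<Longrightarrow> x \<in> S \<Longrightarrow> 1 \<le> phi r p x S"
  shows "percolates V r p' x ((p' - p) / (1 + (p' - p)))"
  unfolding percolates_def
proof (intro allI impI)
  fix F :: "'a set" assume F: "finite F"
  define \<Lambda> where "\<Lambda> = insert x (F \<inter> V \<union> r `` (F \<inter> V))"
  define D where "D = {u \<in> \<Lambda>. \<not> r `` {u} \<subseteq> \<Lambda>}"
  have "finite (r `` (F \<inter> V))" using F by (intro finite_neighbours[OF r(3)] finite_Int disjI1)
  then have fin: "finite \<Lambda>" unfolding \<Lambda>_def using F by simp
  have sub: "\<Lambda> \<subseteq> V" unfolding \<Lambda>_def using x r(1) by blast
  have DF: "u \<notin> F" if "u \<in> D" for u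
  proof
    assume "u \<in> F"
    then have "u \<in> F \<inter> V" using that sub unfolding D_def by blast
    then have "r `` {u} \<subseteq> \<Lambda>" unfolding \<Lambda>_def by blast
    then show False using that unfolding D_def by blast
  qed
  have "(p' - p) / (1 + (p' - p)) \<le> bexp p' \<Lambda> (\<lambda>\<omega>. of_bool (x \<in> reach r \<omega> D))"
  proof (rule hit_lower_bound[where p = p])
    show "finite \<Lambda>" "finite (r `` {v})" "sym r" "0 \<le> p" "p < p'" "p' \<le> 1"
      "D = {u \<in> \<Lambda>. \<not> r `` {u} \<subseteq> \<Lambda>}" for v
      using fin r p D_def by simp_all
    show "x \<in> \<Lambda>" by (simp add: \<Lambda>_def)
    fix S assume "S \<subseteq> \<Lambda>" "x \<in> S"
    moreover from this have "S \<subseteq> V" "finite S" using sub finite_subset[OF _ fin] by blast+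
    ultimately show "1 \<le> phi r p x S" by (intro big)
  qed
  also have "\<dots> \<le> bexp p' \<Lambda> (\<lambda>\<omega>. of_bool (\<not> reach r \<omega> {x} \<subseteq> F))"
  proof (rule bexp_mono)
    fix \<omega>
    have "\<not> reach r \<omega> {x} \<subseteq> F" if hit: "x \<in> reach r \<omega> D"
    proof -
      obtain u where u: "u \<in> D" "x \<in> reach r \<omega> {u}" using reach_from_set[OF hit] by blast
      from u(2) have "u \<in> reach r \<omega> {x}" by (rule reach_sym[OF r(2)])
      then show ?thesis using DF[OF u(1)] by blast
    qed
    then show "(of_bool (x \<in> reach r \<omega> D) :: real) \<le> of_bool (\<not> reach r \<omega> {x} \<subseteq> F)"
      by (simp add: of_bool_def)
  qed (use p in auto)
  finally show "\<exists>\<Lambda>\<subseteq>V. finite \<Lambda> \<and>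
      (p' - p) / (1 + (p' - p)) \<le> bexp p' \<Lambda> (\<lambda>\<omega>. of_bool (\<not> reach r \<omega> {x} \<subseteq> F))"
    using fin sub by (intro exI[of _ \<Lambda>] conjI)
qed

text \<open>
  Some neighbour \<open>z\<close> of \<open>y\<close> lies outside \<open>F\<close>, and it suffices that \<open>y\<close> and \<open>z\<close> are open.
\<close>
lemma percolates_if_infinite_degree:
  assumes r: "r \<subseteq> V \<times> V" and y: "infinite (r `` {y})" and p: "0 \<le> p" "p \<le> 1"
  shows "percolates V r p y (p\<^sup>2)"
  unfolding percolates_def
proof (intro allI impI)
  fix F :: "'a set" assume "finite F"
  then have "infinite (r `` {y} - insert y F)" using y by simp
  then have "r `` {y} - insert y F \<noteq> {}" by (metis finite.emptyI)
  then obtain z where z: "(y, z) \<in> r" "z \<noteq> y" "z \<notin> F" by blast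
  have "y \<in> reach r {y, z} {y}" by (rule reach_start) auto
  then have "z \<in> reach r {y, z} {y}" using z(1) by (rule reach_step) auto
  then have nF: "\<not> reach r (insert y {z}) {y} \<subseteq> F" using z by auto
  let ?g = "\<lambda>\<omega>. of_bool (\<not> reach r \<omega> {y} \<subseteq> F) :: real"
  have "p\<^sup>2 = bexp p {y, z} (\<lambda>\<omega>. of_bool (\<omega> = {y, z}))"
    using z(2) by (simp add: bexp_insert power2_eq_square doubleton_eq_iff)
  also have "\<dots> \<le> bexp p {y, z} ?g"
    using nF by (intro bexp_mono p) auto
  finally have "p\<^sup>2 \<le> bexp p {y, z} ?g" .
  then show "\<exists>\<Lambda>\<subseteq>V. finite \<Lambda> \<and> p\<^sup>2 \<le> bexp p \<Lambda> ?g"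
    using z(1) r by (intro exI[of _ "{y, z}"]) auto
qed

text \<open>
  If \<open>x\<close> is open, its cluster contains the cluster of \<open>y\<close>. Forcing \<open>x\<close> to be open costs a factor \<open>p\<close>.
\<close>
lemma percolates_neighbour:
  assumes r: "r \<subseteq> V \<times> V" "(x, y) \<in> r" and p: "0 \<le> p" "p \<le> 1" and perc: "percolates V r p y c"
  shows "percolates V r p x (p * c)"
  unfolding percolates_def
proof (intro allI impI)
  fix F :: "'a set" assume "finite F"
  let ?g = "\<lambda>y \<omega>. of_bool (\<not> reach r \<omega> {y} \<subseteq> F) :: real"
  obtain \<Lambda> where L: "\<Lambda> \<subseteq> V" "finite \<Lambda>" "c \<le> bexp p \<Lambda> (?g y)"
    using perc \<open>finite F\<close> unfolding percolates_def by blast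
  have "p * c \<le> p * bexp p \<Lambda> (?g y)"
    using L p by (intro mult_left_mono)
  also have "\<dots> \<le> p * bexp p (insert x \<Lambda>) (?g y)"
    using L p by (intro mult_left_mono bexp_superset not_reach_subset_mono) auto
  also have "\<dots> \<le> bexp p (insert x \<Lambda>) (\<lambda>\<omega>. of_bool (x \<in> \<omega>) * ?g y \<omega>)"
    using L p by (intro bexp_force_open not_reach_subset_mono) auto
  also have "\<dots> \<le> bexp p (insert x \<Lambda>) (?g x)"
  proof (rule bexp_mono[OF p])
    fix \<omega>
    have "reach r \<omega> {y} \<subseteq> reach r \<omega> {x}" if "x \<in> \<omega>"
    proof (rule reach_least)
      have "x \<in> reach r \<omega> {x}" using that by (intro reach_start) auto
      then show "{y} \<inter> \<omega> \<subseteq> reach r \<omega> {x}" using r(2) by (blast intro: reach_step)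
    qed (blast intro: reach_step)
    then show "of_bool (x \<in> \<omega>) * ?g y \<omega> \<le> ?g x \<omega>" by auto
  qed
  finally have "p * c \<le> bexp p (insert x \<Lambda>) (?g x)" .
  then show "\<exists>\<Lambda>\<subseteq>V. finite \<Lambda> \<and> p * c \<le> bexp p \<Lambda> (?g x)"
    using L r by (intro exI[of _ "insert x \<Lambda>"]) auto
qed

lemma percolates_connected:
  assumes "r \<subseteq> V \<times> V" "0 < p" "p \<le> 1" "(x, y) \<in> r\<^sup>*" "percolates V r p y c" "0 < c"
  shows "\<exists>c>0. percolates V r p x c"
  using assms(4)
proof (induction rule: converse_rtrancl_induct)
  case base
  show ?case using assms by blast
next
  case (step x z)
  then obtain c' where "c' > 0" "percolates V r p z c'" by blast
  then show ?case
    using percolates_neighbour[OF assms(1) step.hyps(1), of p c'] assms(2,3)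
    by (intro exI[of _ "p * c'"]) auto
qed

definition rel_automorphism :: "'a set \<Rightarrow> ('a \<times> 'a) set \<Rightarrow> ('a \<Rightarrow> 'a) \<Rightarrow> bool" where
  "rel_automorphism V r f \<longleftrightarrow> bij_betw f V V \<and> (\<forall>u\<in>V. \<forall>v\<in>V. (f u, f v) \<in> r \<longleftrightarrow> (u, v) \<in> r)"

lemma phi_automorphism:
  assumes r: "r \<subseteq> V \<times> V" and f: "rel_automorphism V r f" and S: "S \<subseteq> V" "finite S" and x: "x \<in> V"
  shows "phi r p (f x) (f ` S) = phi r p x S"
proof -
  have inj: "inj_on f V" and surj: "f ` V = V"
    and hom: "\<And>u v. u \<in> V \<Longrightarrow> v \<in> V \<Longrightarrow> (f u, f v) \<in> r \<longleftrightarrow> (u, v) \<in> r"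
    using f by (auto simp: rel_automorphism_def bij_betw_def)
  have nbr: "r `` (f ` K) = f ` (r `` K)" if K: "K \<subseteq> V" for K
  proof
    show "r `` (f ` K) \<subseteq> f ` (r `` K)"
    proof
      fix w assume "w \<in> r `` (f ` K)"
      then obtain k where k: "k \<in> K" "(f k, w) \<in> r" by blast
      then obtain v where "v \<in> V" "w = f v" using r surj by blast
      then show "w \<in> f ` (r `` K)" using k K hom[of k v] by blast
    qed
    show "f ` (r `` K) \<subseteq> r `` (f ` K)" using r K hom by blast
  qed
  have "phi r p (f x) (f ` S) = bexp p S (\<lambda>\<omega>. real (card (r `` reach r (f ` \<omega>) (f ` {x}) - f ` S)))"
    unfolding phi_def using S inj_on_subset[OF inj S(1)] by (simp add: bexp_image)
  also have "\<dots> = phi r p x S"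
    unfolding phi_def
  proof (rule bexp_cong)
    fix \<omega> assume w: "\<omega> \<subseteq> S"
    let ?C = "reach r \<omega> {x}"
    have C: "?C \<subseteq> V" using reach_subset[of r \<omega> "{x}"] w S by blast
    have "r `` reach r (f ` \<omega>) (f ` {x}) = f ` (r `` ?C)"
      using w S x hom by (subst reach_image[OF inj]) (auto simp: nbr[OF C])
    moreover have "r `` ?C \<subseteq> V" using r by auto
    then have "f ` (r `` ?C) - f ` S = f ` (r `` ?C - S)" "inj_on f (r `` ?C - S)"
      using S(1) inj by (blast dest: inj_onD, blast intro: inj_on_subset)
    ultimately show "real (card (r `` reach r (f ` \<omega>) (f ` {x}) - f ` S)) = real (card (r `` ?C - S))"
      by (simp add: card_image)
  qed
  finally show ?thesis .
qed

definition finitely_many_orbits :: "'a set \<Rightarrow> ('a \<times> 'a) set \<Rightarrow> bool" where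
  "finitely_many_orbits V r \<longleftrightarrow>
     (\<exists>R\<subseteq>V. finite R \<and> (\<forall>v\<in>V. \<exists>u\<in>R. \<exists>f. rel_automorphism V r f \<and> f u = v))"

text \<open>
  The dichotomy of the proof. Finitely many orbits make the choice of the sets \<open>S\<close> uniform:
  choose them at representatives of the orbits, and transport them by automorphisms.
\<close>
lemma chi_bounded_or_phi_ge_1:
  assumes r: "r \<subseteq> V \<times> V" "\<And>v. finite (r `` {v})" and orb: "finitely_many_orbits V r"
    and p: "0 \<le> p" "p \<le> 1"
  shows "(\<exists>B. \<forall>\<Lambda>\<subseteq>V. finite \<Lambda> \<longrightarrow> (\<forall>x. chi r p \<Lambda> x \<le> B)) \<or>
    (\<exists>x\<in>V. \<forall>S\<subseteq>V. finite S \<longrightarrow> x \<in> S \<longrightarrow> 1 \<le> phi r p x S)"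
proof (rule disjCI)
  assume "\<not> (\<exists>x\<in>V. \<forall>S\<subseteq>V. finite S \<longrightarrow> x \<in> S \<longrightarrow> 1 \<le> phi r p x S)"
  then have "\<forall>x\<in>V. \<exists>S. S \<subseteq> V \<and> finite S \<and> x \<in> S \<and> phi r p x S < 1" by (meson not_less)
  then obtain S where S: "\<And>x. x \<in> V \<Longrightarrow> S x \<subseteq> V \<and> finite (S x) \<and> x \<in> S x \<and> phi r p x (S x) < 1"
    by metis
  obtain R where R: "R \<subseteq> V" "finite R"
    "\<And>v. v \<in> V \<Longrightarrow> \<exists>u\<in>R. \<exists>f. rel_automorphism V r f \<and> f u = v"
    using orb unfolding finitely_many_orbits_def by blast
  define m where "m = (\<Sum>u\<in>R. card (S u))"
  define \<delta> where "\<delta> = Min (insert 1 ((\<lambda>u. 1 - phi r p u (S u)) ` R))"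
  have m: "card (S u) \<le> m" if "u \<in> R" for u
    unfolding m_def using that R(2) by (intro member_le_sum) auto
  have \<delta>: "0 < \<delta>" unfolding \<delta>_def using R S by (subst Min_gr_iff) auto
  have \<delta>': "\<delta> \<le> 1 - phi r p u (S u)" if "u \<in> R" for u
    unfolding \<delta>_def using that R(2) by (intro Min_le) auto
  have "chi r p \<Lambda> x \<le> real m / \<delta>" if L: "\<Lambda> \<subseteq> V" "finite \<Lambda>" for \<Lambda> x
  proof (rule chi_bound[OF L(2) r(2) p \<delta>])
    fix v assume "v \<in> \<Lambda>"
    then obtain u f where u: "u \<in> R" and f: "rel_automorphism V r f" "f u = v" using L R(3) by blast
    have uV: "u \<in> V" using u R by blast
    have "phi r p v (f ` S u) = phi r p u (S u)"
      using phi_automorphism[OF r(1) f(1) _ _ uV, of "S u"] S[OF uV] f(2) by simp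
    then show "\<exists>S. finite S \<and> v \<in> S \<and> card S \<le> m \<and> phi r p v S \<le> 1 - \<delta>"
      using S[OF uV] m[OF u] \<delta>'[OF u] f(2) card_image_le[of "S u" f]
      by (intro exI[of _ "f ` S u"]) force
  qed
  then show "\<exists>B. \<forall>\<Lambda>\<subseteq>V. finite \<Lambda> \<longrightarrow> (\<forall>x. chi r p \<Lambda> x \<le> B)" by blast
qed

section \<open>The product measure and events depending on finitely many coordinates\<close>
lemma space_bernoulli_product: "space (bernoulli_product I p) = (\<Pi>\<^sub>E i\<in>I. UNIV)"
  by (simp add: bernoulli_product_def space_PiM)

lemma prob_space_bernoulli_product: "prob_space (bernoulli_product I p)"
  unfolding bernoulli_product_def by (intro prob_space_PiM prob_space_measure_pmf)

lemma bernoulli_product_pattern: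
  assumes p: "0 \<le> p" "p \<le> 1" and J: "finite J" "J \<subseteq> I" and a: "a \<subseteq> J"
  defines "T \<equiv> {\<omega> \<in> space (bernoulli_product I p). {v\<in>J. \<omega> v} = a}"
  shows "T \<in> sets (bernoulli_product I p)"
    and "emeasure (bernoulli_product I p) T = ennreal (p ^ card a * (1 - p) ^ card (J - a))"
proof -
  let ?M = "\<lambda>_. measure_pmf (bernoulli_pmf p)"
  let ?X = "\<lambda>v. {v \<in> a}"
  have T: "T = prod_emb I ?M J (Pi\<^sub>E J ?X)"
    using J(2) a unfolding T_def space_bernoulli_product prod_emb_def
    by (auto simp: PiE_iff restrict_def extensional_def)
  show "T \<in> sets (bernoulli_product I p)"
    unfolding T bernoulli_product_def using J by (intro sets_PiM_I) auto
  have "emeasure (bernoulli_product I p) T = (\<Prod>v\<in>J. emeasure (measure_pmf (bernoulli_pmf p)) (?X v))"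
    unfolding T bernoulli_product_def using J
    by (intro emeasure_PiM_emb) (auto intro: prob_space_measure_pmf)
  also have "\<dots> = (\<Prod>v\<in>J. ennreal (if v \<in> a then p else 1 - p))"
    using p by (intro prod.cong) (auto simp: emeasure_pmf_single)
  also have "\<dots> = ennreal (\<Prod>v\<in>J. if v \<in> a then p else 1 - p)"
    using p by (intro prod_ennreal) auto
  also have "(\<Prod>v\<in>J. if v \<in> a then p else 1 - p) = p ^ card a * (1 - p) ^ card (J - a)"
    using J a by (subst prod.If_cases) (auto simp: Int_absorb1 Diff_eq)
  finally show "emeasure (bernoulli_product I p) T = ennreal (p ^ card a * (1 - p) ^ card (J - a))" .
qed

text \<open>
  The product measure agrees with \<open>bexp\<close> on functions of finitely many coordinates: decompose according to
  the pattern of open coordinates in \<open>J\<close>; each pattern is a cylinder of known measure.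
\<close>
lemma bernoulli_product_finite_dependence:
  fixes g :: "'i set \<Rightarrow> real"
  assumes p: "0 \<le> p" "p \<le> 1" and J: "finite J" "J \<subseteq> I" and g: "\<And>a. 0 \<le> g a"
  defines "M \<equiv> bernoulli_product I p"
  shows "(\<lambda>\<omega>. ennreal (g {v\<in>J. \<omega> v})) \<in> borel_measurable M"
    and "(\<integral>\<^sup>+ \<omega>. ennreal (g {v\<in>J. \<omega> v}) \<partial>M) = ennreal (bexp p J g)"
proof -
  define T where "T a = {\<omega> \<in> space M. {v\<in>J. \<omega> v} = a}" for a
  note T = bernoulli_product_pattern[OF p J, folded M_def, folded T_def]
  have eq: "ennreal (g {v\<in>J. \<omega> v}) = (\<Sum>a\<in>Pow J. ennreal (g a) * indicator (T a) \<omega>)"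
    if "\<omega> \<in> space M" for \<omega>
  proof -
    have "(\<Sum>a\<in>Pow J. ennreal (g a) * indicator (T a) \<omega>)
        = (\<Sum>a\<in>Pow J. if {v\<in>J. \<omega> v} = a then ennreal (g a) else 0)"
      using that by (intro sum.cong) (auto simp: T_def indicator_def)
    then show ?thesis using J by (simp add: sum.delta)
  qed
  have meas: "(\<lambda>\<omega>. \<Sum>a\<in>Pow J. ennreal (g a) * indicator (T a) \<omega>) \<in> borel_measurable M"
    using T(1) by (intro borel_measurable_sum borel_measurable_times borel_measurable_indicator) auto
  then show "(\<lambda>\<omega>. ennreal (g {v\<in>J. \<omega> v})) \<in> borel_measurable M"
    using eq by (subst measurable_cong)
  have "(\<integral>\<^sup>+ \<omega>. ennreal (g {v\<in>J. \<omega> v}) \<partial>M)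
      = (\<integral>\<^sup>+ \<omega>. (\<Sum>a\<in>Pow J. ennreal (g a) * indicator (T a) \<omega>) \<partial>M)"
    using eq by (rule nn_integral_cong)
  also have "\<dots> = (\<Sum>a\<in>Pow J. ennreal (g a) * emeasure M (T a))"
    using T(1) by (subst nn_integral_sum) (auto intro!: sum.cong nn_integral_cmult_indicator)
  also have "\<dots> = (\<Sum>a\<in>Pow J. ennreal (p ^ card a * (1 - p) ^ card (J - a) * g a))"
    using T(2) p g by (intro sum.cong) (auto simp: ennreal_mult' mult.commute)
  also have "\<dots> = ennreal (bexp p J g)"
    unfolding bexp_def using p g by (intro sum_ennreal) auto
  finally show "(\<integral>\<^sup>+ \<omega>. ennreal (g {v\<in>J. \<omega> v}) \<partial>M) = ennreal (bexp p J g)" .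
qed

lemma bernoulli_product_finite_event:
  assumes p: "0 \<le> p" "p \<le> 1" and J: "finite J" "J \<subseteq> I"
  defines "M \<equiv> bernoulli_product I p"
  shows "{\<omega> \<in> space M. Q {v\<in>J. \<omega> v}} \<in> sets M"
    and "measure M {\<omega> \<in> space M. Q {v\<in>J. \<omega> v}} = bexp p J (\<lambda>\<omega>. of_bool (Q \<omega>))"
proof -
  let ?T = "{\<omega> \<in> space M. Q {v\<in>J. \<omega> v}}"
  note fd = bernoulli_product_finite_dependence[OF p J, of "\<lambda>\<omega>. of_bool (Q \<omega>)", folded M_def]
  have "?T = (\<lambda>\<omega>. ennreal (of_bool (Q {v\<in>J. \<omega> v}))) -` {1} \<inter> space M"
    by (auto simp: of_bool_def split: if_splits)
  then show sets: "?T \<in> sets M"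
    using measurable_sets[OF fd(1), of "{1}"] by simp
  have "emeasure M ?T = (\<integral>\<^sup>+ \<omega>. indicator ?T \<omega> \<partial>M)"
    using sets by simp
  also have "\<dots> = (\<integral>\<^sup>+ \<omega>. ennreal (of_bool (Q {v\<in>J. \<omega> v})) \<partial>M)"
    by (rule nn_integral_cong) (auto simp: indicator_def)
  also have "\<dots> = ennreal (bexp p J (\<lambda>\<omega>. of_bool (Q \<omega>)))"
    by (rule fd(2)) simp
  finally show "measure M ?T = bexp p J (\<lambda>\<omega>. of_bool (Q \<omega>))"
    using bexp_nonneg[OF p, of J "\<lambda>\<omega>. of_bool (Q \<omega>)"] by (simp add: measure_def)
qed

lemma AE_bernoulli_product_0:
  assumes "countable I"
  shows "AE \<omega> in bernoulli_product I 0. \<forall>i\<in>I. \<not> \<omega> i"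
proof -
  interpret product_prob_space "\<lambda>_. measure_pmf (bernoulli_pmf 0)" I
    by standard
  have "AE \<omega> in bernoulli_product I 0. \<not> \<omega> i" if "i \<in> I" for i
    unfolding bernoulli_product_def
    by (rule AE_component[OF that]) (auto simp: AE_measure_pmf_iff set_pmf_eq pmf_bernoulli_True)
  then show ?thesis using assms by (simp add: AE_ball_countable)
qed

lemma ext_card_eq_emeasure: "ext_card A = emeasure (count_space UNIV) A"
  by (simp add: ext_card_def emeasure_count_space)

lemma ext_card_UN_incseq:
  assumes "incseq A" "\<And>n. finite (A n)"
  shows "ext_card (\<Union>n. A n) = (SUP n. of_nat (card (A n)))"
proof -
  have "ext_card (\<Union>n. A n) = (SUP n. ext_card (A n))"
    unfolding ext_card_eq_emeasure using assms(1) by (intro SUP_emeasure_incseq[symmetric]) auto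
  then show ?thesis using assms(2) by (simp add: ext_card_def)
qed

lemma finite_subset_incseq:
  assumes "finite C" "C \<subseteq> (\<Union>n. A n)" "incseq A"
  shows "\<exists>n. C \<subseteq> A (n::nat)"
  using assms(1,2)
proof (induction C rule: finite_induct)
  case (insert c C)
  then obtain m n where "C \<subseteq> A m" "c \<in> A n" by auto
  moreover have "A m \<subseteq> A (max m n)" "A n \<subseteq> A (max m n)" using incseqD[OF assms(3)] by auto
  ultimately show ?case by blast
qed simp

lemma reach_UN_incseq:
  assumes "incseq A"
  shows "reach r (\<Union>n. A n) D = (\<Union>n::nat. reach r (A n) D)"
proof
  show "reach r (\<Union>n. A n) D \<subseteq> (\<Union>n. reach r (A n) D)"
  proof (rule reach_least)
    show "D \<inter> (\<Union>n. A n) \<subseteq> (\<Union>n. reach r (A n) D)" by (auto intro: reach_start)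
  next
    fix y z assume "y \<in> (\<Union>n. reach r (A n) D)" "(y, z) \<in> r" "z \<in> (\<Union>n. A n)"
    then obtain m n where mn: "y \<in> reach r (A m) D" "z \<in> A n" by blast
    have "A m \<subseteq> A (max m n)" "A n \<subseteq> A (max m n)" using incseqD[OF assms] by auto
    then have "y \<in> reach r (A (max m n)) D" "z \<in> A (max m n)"
      using mn reach_mono[of "A m" "A (max m n)" D D r] by auto
    then show "z \<in> (\<Union>n. reach r (A n) D)" using \<open>(y, z) \<in> r\<close> by (blast intro: reach_step)
  qed
  show "(\<Union>n. reach r (A n) D) \<subseteq> reach r (\<Union>n. A n) D"
    by (intro UN_least reach_mono) auto
qed

section \<open>Site percolation\<close>
locale percolation_graph =
  fixes V :: "'a set" and r :: "('a \<times> 'a) set"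
  assumes edges: "r \<subseteq> V \<times> V" and sym: "sym r" and countable: "countable V"
    and connected: "\<And>u v. u \<in> V \<Longrightarrow> v \<in> V \<Longrightarrow> (u, v) \<in> r\<^sup>*"
begin

definition cluster :: "'a \<Rightarrow> ('a \<Rightarrow> bool) \<Rightarrow> 'a set" where
  "cluster x \<omega> = reach r {v\<in>V. \<omega> v} {x}"

text \<open>
  An increasing exhaustion of \<open>V\<close> by finite sets. The case distinction is due to
  \<open>from_nat_into\<close>, which enumerates nonempty sets only.
\<close>
definition box :: "nat \<Rightarrow> 'a set" where
  "box n = (if V = {} then {} else from_nat_into V ` {..<n})"

lemma box: "finite (box n)" "box n \<subseteq> V" "incseq box" "(\<Union>n. box n) = V"
proof -
  show "finite (box n)" by (simp add: box_def)
  show "box n \<subseteq> V" by (auto simp: box_def intro!: from_nat_into)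
  show "incseq box" by (auto simp: incseq_def box_def)
  show "(\<Union>n. box n) = V"
  proof (cases "V = {}")
    case False
    have "(\<Union>n. {..<n}) = (UNIV :: nat set)" by auto
    then have "(\<Union>n. box n) = range (from_nat_into V)"
      using False unfolding box_def by (simp add: image_UN[symmetric])
    then show ?thesis using False countable by (simp add: range_from_nat_into)
  next
    case True
    then show ?thesis unfolding box_def by simp
  qed
qed

lemma cluster_eq_UN: "cluster x \<omega> = (\<Union>n. reach r {v\<in>box n. \<omega> v} {x})"
proof -
  have "{v\<in>V. \<omega> v} = (\<Union>n. {v\<in>box n. \<omega> v})" using box(4) by auto
  moreover have "incseq (\<lambda>n. {v\<in>box n. \<omega> v})" using box(3) by (auto simp: incseq_def)
  ultimately show ?thesis by (simp add: cluster_def reach_UN_incseq)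
qed

lemma ext_card_cluster: "ext_card (cluster x \<omega>) = (SUP n. of_nat (card (reach r {v\<in>box n. \<omega> v} {x})))"
  unfolding cluster_eq_UN
proof (rule ext_card_UN_incseq)
  show "incseq (\<lambda>n. reach r {v\<in>box n. \<omega> v} {x})"
    by (intro monoI reach_mono) (use incseqD[OF box(3)] in blast)+
  show "finite (reach r {v\<in>box n. \<omega> v} {x})" for n using box by (intro finite_reach) simp
qed

lemma cluster_subset: "cluster x \<omega> \<subseteq> V"
  unfolding cluster_def using reach_subset by fast

context
  fixes p :: real
  assumes p: "0 \<le> p" "p \<le> 1"
begin

abbreviation "M \<equiv> bernoulli_product V p"

lemma measurable_finite_cluster:
  "(\<lambda>\<omega>. of_nat (card (reach r {v\<in>box n. \<omega> v} {x})) :: ennreal) \<in> borel_measurable M"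
  using bernoulli_product_finite_dependence(1)[OF p box(1,2), of "\<lambda>a. real (card (reach r a {x}))" n]
  by (simp add: ennreal_of_nat_eq_real_of_nat)

lemma measurable_ext_card_cluster: "(\<lambda>\<omega>. ext_card (cluster x \<omega>)) \<in> borel_measurable M"
  unfolding ext_card_cluster using measurable_finite_cluster by (intro borel_measurable_SUP) auto

lemma expected_cluster_le:
  assumes "\<And>n. chi r p (box n) x \<le> B"
  shows "(\<integral>\<^sup>+ \<omega>. ext_card (cluster x \<omega>) \<partial>M) \<le> ennreal B"
proof -
  let ?c = "\<lambda>n \<omega>. of_nat (card (reach r {v\<in>box n. \<omega> v} {x})) :: ennreal"
  have inc: "incseq ?c"
    unfolding incseq_def le_fun_def
  proof (intro allI impI)
    fix m n \<omega> assume "m \<le> (n::nat)"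
    then have "{v\<in>box m. \<omega> v} \<subseteq> {v\<in>box n. \<omega> v}" using incseqD[OF box(3)] by blast
    then have "reach r {v\<in>box m. \<omega> v} {x} \<subseteq> reach r {v\<in>box n. \<omega> v} {x}" by (intro reach_mono) auto
    then show "?c m \<omega> \<le> ?c n \<omega>"
      using box(1)[of n] by (intro of_nat_mono card_mono finite_reach) auto
  qed
  have "(\<integral>\<^sup>+ \<omega>. ext_card (cluster x \<omega>) \<partial>M) = (SUP n. \<integral>\<^sup>+ \<omega>. ?c n \<omega> \<partial>M)"
    unfolding ext_card_cluster using inc measurable_finite_cluster
    by (intro nn_integral_monotone_convergence_SUP) auto
  also have "\<dots> = (SUP n. ennreal (chi r p (box n) x))"
    using bernoulli_product_finite_dependence(2)[OF p box(1,2), of "\<lambda>a. real (card (reach r a {x}))"]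
    by (simp add: chi_def ennreal_of_nat_eq_real_of_nat)
  also have "\<dots> \<le> ennreal B" using assms by (intro SUP_least ennreal_leI)
  finally show ?thesis .
qed

text \<open>
  The events that the cluster leaves \<open>box n\<close> decrease to the event that it is infinite, and each of
  them has probability at least \<open>c\<close>.
\<close>
lemma infinite_cluster_if_percolates:
  assumes perc: "percolates V r p x c" and c: "0 < c"
  shows "0 < measure M {\<omega> \<in> space M. ext_card (cluster x \<omega>) = \<infinity>}"
proof -
  interpret M: prob_space M by (rule prob_space_bernoulli_product)
  define A where "A n = {\<omega> \<in> space M. \<not> cluster x \<omega> \<subseteq> box n}" for n
  have "A n = (\<Union>k. {\<omega> \<in> space M. \<not> reach r {v\<in>box k. \<omega> v} {x} \<subseteq> box n})" for n
    unfolding A_def cluster_eq_UN by auto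
  then have meas: "A n \<in> sets M" for n
    using bernoulli_product_finite_event(1)[OF p box(1,2)] by auto
  have low: "c \<le> measure M (A n)" for n
  proof -
    obtain \<Lambda> where L: "\<Lambda> \<subseteq> V" "finite \<Lambda>" "c \<le> bexp p \<Lambda> (\<lambda>\<omega>. of_bool (\<not> reach r \<omega> {x} \<subseteq> box n))"
      using perc box(1)[of n] unfolding percolates_def by blast
    let ?B = "{\<omega> \<in> space M. \<not> reach r {v\<in>\<Lambda>. \<omega> v} {x} \<subseteq> box n}"
    have "reach r {v\<in>\<Lambda>. \<omega> v} {x} \<subseteq> cluster x \<omega>" for \<omega>
      unfolding cluster_def using L by (intro reach_mono) auto
    then have "?B \<subseteq> A n" unfolding A_def by blast
    then have "measure M ?B \<le> measure M (A n)" by (intro M.finite_measure_mono meas)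
    moreover have "measure M ?B = bexp p \<Lambda> (\<lambda>\<omega>. of_bool (\<not> reach r \<omega> {x} \<subseteq> box n))"
      by (rule bernoulli_product_finite_event(2)[OF p L(2,1)])
    ultimately show ?thesis using L by linarith
  qed
  have "decseq A"
    unfolding decseq_def
  proof (intro allI impI)
    fix m n :: nat assume "m \<le> n"
    then have "box m \<subseteq> box n" by (rule incseqD[OF box(3)])
    then show "A n \<subseteq> A m" unfolding A_def by blast
  qed
  then have "(\<lambda>n. measure M (A n)) \<longlonglongrightarrow> measure M (\<Inter>n. A n)"
    using meas by (intro M.finite_Lim_measure_decseq) auto
  then have "c \<le> measure M (\<Inter>n. A n)"
    by (rule LIMSEQ_le_const) (use low in auto)
  moreover have "(\<Inter>n. A n) = {\<omega> \<in> space M. ext_card (cluster x \<omega>) = \<infinity>}"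
  proof -
    have "(\<forall>n. \<not> cluster x \<omega> \<subseteq> box n) \<longleftrightarrow> infinite (cluster x \<omega>)" for \<omega>
    proof -
      have "\<exists>n. cluster x \<omega> \<subseteq> box n" if "finite (cluster x \<omega>)"
        using that cluster_subset[of x \<omega>] box(3,4) by (intro finite_subset_incseq) auto
      then show ?thesis using finite_subset[OF _ box(1)] by blast
    qed
    then show ?thesis by (auto simp: A_def ext_card_def)
  qed
  ultimately show ?thesis using c by simp
qed

end

lemma infinite_cluster_if_infinite_degree:
  assumes "x \<in> V" "infinite (r `` {y})" "0 < p" "p \<le> 1"
  shows "0 < measure (bernoulli_product V p)
           {\<omega> \<in> space (bernoulli_product V p). ext_card (cluster x \<omega>) = \<infinity>}"
proof -
  have "r `` {y} \<noteq> {}" using assms(2) by force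
  then have "y \<in> V" using edges by blast
  moreover have "percolates V r p y (p\<^sup>2)"
    using assms by (intro percolates_if_infinite_degree edges) auto
  ultimately obtain c where "c > 0" "percolates V r p x c"
    using percolates_connected[OF edges assms(3,4) connected[OF assms(1)], of y "p\<^sup>2"] assms(3) by auto
  then show ?thesis using assms by (intro infinite_cluster_if_percolates) auto
qed

text \<open>
  In the first case of the dichotomy the expected cluster size at \<open>p\<close> would be finite. So the second
  case applies, at some vertex \<open>y\<close>, and connectedness leads from \<open>y\<close> to \<open>x\<close>.
\<close>
lemma infinite_cluster_if_infinite_expectation:
  assumes x: "x \<in> V" and deg: "\<And>v. finite (r `` {v})" and orb: "finitely_many_orbits V r"
    and p: "0 \<le> p" "p < p'" "p' \<le> 1"
    and inf: "(\<integral>\<^sup>+ \<omega>. ext_card (cluster x \<omega>) \<partial>bernoulli_product V p) = \<infinity>"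
  shows "0 < measure (bernoulli_product V p')
           {\<omega> \<in> space (bernoulli_product V p'). ext_card (cluster x \<omega>) = \<infinity>}"
proof -
  have unbounded: "\<not> (\<exists>B. \<forall>\<Lambda>\<subseteq>V. finite \<Lambda> \<longrightarrow> (\<forall>x. chi r p \<Lambda> x \<le> B))"
  proof
    assume "\<exists>B. \<forall>\<Lambda>\<subseteq>V. finite \<Lambda> \<longrightarrow> (\<forall>x. chi r p \<Lambda> x \<le> B)"
    then obtain B where "\<forall>\<Lambda>\<subseteq>V. finite \<Lambda> \<longrightarrow> (\<forall>x. chi r p \<Lambda> x \<le> B)" ..
    then have "chi r p (box n) x \<le> B" for n using box(1,2)[of n] by simp
    then have "(\<integral>\<^sup>+ \<omega>. ext_card (cluster x \<omega>) \<partial>bernoulli_product V p) \<le> ennreal B"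
      using p by (intro expected_cluster_le) simp_all
    then show False using inf by (simp add: top_unique)
  qed
  have p1: "p \<le> 1" using p by simp
  have "\<exists>y\<in>V. \<forall>S\<subseteq>V. finite S \<longrightarrow> y \<in> S \<longrightarrow> 1 \<le> phi r p y S"
    using chi_bounded_or_phi_ge_1[OF edges deg orb p(1) p1]
    by (rule disjE) (use unbounded in \<open>blast+\<close>)
  then obtain y where y: "y \<in> V" "\<And>S. S \<subseteq> V \<Longrightarrow> finite S \<Longrightarrow> y \<in> S \<Longrightarrow> 1 \<le> phi r p y S"
    by blast
  have "percolates V r p' y ((p' - p) / (1 + (p' - p)))"
    by (rule percolates_if_phi_ge_1[OF edges sym deg y(1) p y(2)])
  moreover have "0 < p'" "0 < (p' - p) / (1 + (p' - p))" using p by simp_all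
  ultimately obtain c where "c > 0" "percolates V r p' x c"
    using percolates_connected[OF edges _ p(3) connected[OF x y(1)]] by meson
  then show ?thesis using p by (intro infinite_cluster_if_percolates) auto
qed

end

section \<open>Graphs and their line graphs\<close>

definition adj :: "'v set set \<Rightarrow> ('v \<times> 'v) set" where
  "adj E = {(u, v). {u, v} \<in> E}"

lemma sym_adj: "sym (adj E)"
  by (auto simp: adj_def sym_def insert_commute)

lemma simple_graphE:
  assumes "simple_graph V E" "e \<in> E"
  obtains u v where "u \<in> V" "v \<in> V" "u \<noteq> v" "e = {u, v}"
  using bspec[OF assms(1)[unfolded simple_graph_def] assms(2)] that by (elim bexE conjE)

lemma simple_graph_edge_subset:
  assumes "simple_graph V E" "e \<in> E"
  shows "e \<subseteq> V"
  using assms by (rule simple_graphE) simp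

lemma adj_subset:
  assumes "simple_graph V E"
  shows "adj E \<subseteq> V \<times> V"
proof
  fix z assume "z \<in> adj E"
  then obtain u v where z: "z = (u, v)" "{u, v} \<in> E" by (auto simp: adj_def)
  then show "z \<in> V \<times> V" using simple_graph_edge_subset[OF assms z(2)] by simp
qed

lemma component_eq_reach:
  assumes "simple_graph V E"
  shows "component V E x = reach (adj E) V {x}"
proof -
  have "Restr (adj E) V = adj E" using adj_subset[OF assms] by blast
  then have "reach (adj E) V {x} = (adj E)\<^sup>* `` ({x} \<inter> V)" by (simp add: reach_def)
  then show ?thesis
    using reach_subset[of "adj E" V "{x}"] unfolding component_def adj_def by blast
qed

lemma site_cluster_eq_reach:
  assumes "simple_graph V E"
  shows "site_cluster V E x \<omega> = reach (adj E) {v\<in>V. \<omega> v} {x}"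
proof -
  let ?U = "{v\<in>V. \<omega> v}" and ?F = "{e\<in>E. \<forall>v\<in>e. \<omega> v}"
  have "simple_graph ?U ?F"
    unfolding simple_graph_def
  proof
    fix e assume e: "e \<in> ?F"
    then have "e \<in> E" by simp
    with assms obtain u v where "u \<in> V" "v \<in> V" "u \<noteq> v" "e = {u, v}"
      by (rule simple_graphE)
    moreover from this have "\<omega> u" "\<omega> v" using e by simp_all
    ultimately show "\<exists>u\<in>?U. \<exists>v\<in>?U. u \<noteq> v \<and> e = {u, v}" by blast
  qed
  moreover have "Restr (adj ?F) ?U = Restr (adj E) ?U"
    by (auto simp: adj_def)
  ultimately show ?thesis
    by (simp add: site_cluster_def component_eq_reach reach_def)
qed

lemma bond_cluster_eq_reach:
  assumes "simple_graph V E"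
  shows "bond_cluster V E x \<omega> = reach (adj {e\<in>E. \<omega> e}) V {x}"
proof -
  have "simple_graph V {e\<in>E. \<omega> e}" using assms unfolding simple_graph_def by blast
  then show ?thesis unfolding bond_cluster_def by (rule component_eq_reach)
qed

lemma connected_graph_adj:
  assumes "connected_graph V E" "u \<in> V" "v \<in> V"
  shows "(u, v) \<in> (adj E)\<^sup>*"
proof -
  have "v \<in> component V E u" using assms by (simp add: connected_graph_def)
  then show ?thesis by (simp add: component_def adj_def)
qed

lemma percolation_graph_adj:
  assumes "simple_graph V E" "countable V" "connected_graph V E"
  shows "percolation_graph V (adj E)"
  by (rule percolation_graph.intro[OF adj_subset[OF assms(1)] sym_adj assms(2) connected_graph_adj[OF assms(3)]])

text \<open>
  One representative is chosen from each orbit.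
\<close>
lemma finitely_many_orbits_adj:
  assumes "quasi_transitive V E"
  shows "finitely_many_orbits V (adj E)"
  unfolding finitely_many_orbits_def
proof (intro exI conjI ballI)
  define rep where "rep A = (SOME v. v \<in> V \<and> aut_orbit V E v = A)" for A
  let ?R = "rep ` aut_orbit V E ` V"
  have rep: "rep (aut_orbit V E v) \<in> V \<and> aut_orbit V E (rep (aut_orbit V E v)) = aut_orbit V E v"
    if "v \<in> V" for v
    unfolding rep_def by (rule someI[of _ v]) (use that in simp)
  show "?R \<subseteq> V" using rep by blast
  show "finite ?R" using assms by (simp add: quasi_transitive_def)
  fix v assume v: "v \<in> V"
  have "graph_automorphism V E id" by (simp add: graph_automorphism_def)
  then have "v \<in> aut_orbit V E v" unfolding aut_orbit_def by (metis (mono_tags) CollectI id_apply)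
  then have "v \<in> aut_orbit V E (rep (aut_orbit V E v))" using rep[OF v] by simp
  then have "\<exists>f. v = f (rep (aut_orbit V E v)) \<and> graph_automorphism V E f"
    by (subst (asm) (1) aut_orbit_def) simp
  then obtain f where "graph_automorphism V E f" "f (rep (aut_orbit V E v)) = v"
    by metis
  then show "\<exists>u\<in>?R. \<exists>f. rel_automorphism V (adj E) f \<and> f u = v"
    using v by (intro bexI[of _ "rep (aut_orbit V E v)"] exI[of _ f])
      (auto simp: graph_automorphism_def rel_automorphism_def adj_def)
qed

text \<open>
  Adjacency in the line graph.
\<close>
definition line_adj :: "'v set set \<Rightarrow> ('v set \<times> 'v set) set" where
  "line_adj E = {(e, e'). e \<in> E \<and> e' \<in> E \<and> e \<noteq> e' \<and> e \<inter> e' \<noteq> {}}"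

lemma edge_at:
  assumes "simple_graph V E" "e \<in> E" "u \<in> e"
  shows "\<exists>v. e = {u, v} \<and> (u, v) \<in> adj E"
proof -
  obtain a b where "e = {a, b}" using assms(1,2) by (rule simple_graphE)
  then have "e = {u, a} \<or> e = {u, b}" using assms(3) by auto
  then show ?thesis using assms(2) by (auto simp: adj_def)
qed

text \<open>
  The edges along a path of the graph form a path in the line graph.
\<close>
lemma percolation_graph_line:
  assumes G: "simple_graph V E" "countable V" "connected_graph V E"
  shows "percolation_graph E (line_adj E)"
proof
  show "line_adj E \<subseteq> E \<times> E" by (auto simp: line_adj_def)
  show "sym (line_adj E)" by (auto simp: line_adj_def sym_def)
  have "E \<subseteq> (\<lambda>(u, v). {u, v}) ` (V \<times> V)"
  proof
    fix e assume "e \<in> E"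
    with G(1) obtain u v where "u \<in> V" "v \<in> V" "e = {u, v}" by (rule simple_graphE)
    then show "e \<in> (\<lambda>(u, v). {u, v}) ` (V \<times> V)" by (intro image_eqI[of _ _ "(u, v)"]) simp_all
  qed
  moreover have "countable (V \<times> V)" using G(2) by simp
  ultimately show "countable E" by (meson countable_image countable_subset)
  have meet: "(e, g) \<in> (line_adj E)\<^sup>*" if "e \<in> E" "g \<in> E" "w \<in> e" "w \<in> g" for e g w
    using that by (cases "e = g") (auto simp: line_adj_def)
  fix e f assume e: "e \<in> E" and f: "f \<in> E"
  obtain u v where uv: "u \<in> e" "v \<in> f" "u \<in> V" "v \<in> V"
    using simple_graphE[OF G(1) e] simple_graphE[OF G(1) f] by (metis insertI1)
  have "(u, v) \<in> (adj E)\<^sup>*" using connected_graph_adj[OF G(3) uv(3,4)] .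
  then have "\<forall>f\<in>E. v \<in> f \<longrightarrow> (e, f) \<in> (line_adj E)\<^sup>*"
  proof (induction rule: rtrancl_induct)
    case base
    show ?case using meet[OF e _ uv(1)] by blast
  next
    case (step w w')
    have g: "{w, w'} \<in> E" using step.hyps(2) by (simp add: adj_def)
    then have "(e, {w, w'}) \<in> (line_adj E)\<^sup>*" using step.IH by blast
    then show ?case using meet[OF g, of _ w'] by (meson insertCI rtrancl_trans)
  qed
  then show "(e, f) \<in> (line_adj E)\<^sup>*" using f uv by blast
qed

lemma finite_line_degree:
  assumes G: "simple_graph V E" and deg: "\<And>v. finite (adj E `` {v})"
  shows "finite {e\<in>E. u \<in> e}" "finite (line_adj E `` {e})"
proof -
  have fin: "finite {e\<in>E. u \<in> e}" for u
  proof (rule finite_subset)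
    show "{e\<in>E. u \<in> e} \<subseteq> (\<lambda>v. {u, v}) ` (adj E `` {u})" using edge_at[OF G] by fastforce
  qed (use deg in simp)
  then show "finite {e\<in>E. u \<in> e}" .
  show "finite (line_adj E `` {e})"
  proof (cases "e \<in> E")
    case True
    with G obtain a b where "e = {a, b}" by (rule simple_graphE)
    then have "line_adj E `` {e} \<subseteq> {e\<in>E. a \<in> e} \<union> {e\<in>E. b \<in> e}" by (auto simp: line_adj_def)
    then show ?thesis using fin by (meson finite_UnI finite_subset)
  qed (simp add: line_adj_def)
qed

lemma infinite_line_degree:
  assumes "infinite (adj E `` {y})"
  shows "\<exists>e. infinite (line_adj E `` {e})"
proof -
  have "adj E `` {y} \<noteq> {}" using assms by force
  then obtain z where z: "{y, z} \<in> E" by (auto simp: adj_def)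
  have "inj_on (\<lambda>v. {y, v}) (adj E `` {y} - {z})" by (auto simp: inj_on_def doubleton_eq_iff)
  moreover have "infinite (adj E `` {y} - {z})" using assms by simp
  ultimately have "infinite ((\<lambda>v. {y, v}) ` (adj E `` {y} - {z}))" by (simp add: finite_image_iff)
  moreover have "(\<lambda>v. {y, v}) ` (adj E `` {y} - {z}) \<subseteq> line_adj E `` {{y, z}}"
    using z by (auto simp: line_adj_def adj_def doubleton_eq_iff)
  ultimately show ?thesis by (meson finite_subset)
qed

lemma rel_automorphism_line:
  assumes G: "simple_graph V E" and f: "rel_automorphism V (adj E) f"
  shows "rel_automorphism E (line_adj E) (image f)"
proof -
  have inj: "inj_on f V" and surj: "f ` V = V"
    and hom: "\<And>u v. u \<in> V \<Longrightarrow> v \<in> V \<Longrightarrow> {f u, f v} \<in> E \<longleftrightarrow> {u, v} \<in> E"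
    using f by (auto simp: rel_automorphism_def bij_betw_def adj_def)
  have pair: "\<exists>u\<in>V. \<exists>v\<in>V. e = {u, v}" if "e \<in> E" for e
    using simple_graphE[OF G that] by metis
  have sub: "e \<subseteq> V" if "e \<in> E" for e using pair[OF that] by blast
  have mem: "f ` e \<in> E" if "e \<in> E" for e
    using pair[OF that] hom that by auto
  have inj': "inj_on (image f) E"
    using inj_on_image_eq_iff[OF inj sub sub] by (intro inj_onI) blast
  have "E \<subseteq> image f ` E"
  proof
    fix e assume e: "e \<in> E"
    then obtain u v where uv: "u \<in> V" "v \<in> V" "e = {u, v}" using pair by blast
    then have "u \<in> f ` V" "v \<in> f ` V" using surj by simp_all
    then obtain a b where ab: "a \<in> V" "b \<in> V" "u = f a" "v = f b" by blast
    then have "{a, b} \<in> E" using hom[of a b] e uv by simp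
    moreover have "e = f ` {a, b}" using uv ab by simp
    ultimately show "e \<in> image f ` E" by blast
  qed
  then have "bij_betw (image f) E E" using inj' mem by (auto simp: bij_betw_def)
  moreover have "(f ` e, f ` e') \<in> line_adj E \<longleftrightarrow> (e, e') \<in> line_adj E" if "e \<in> E" "e' \<in> E" for e e'
  proof -
    have "f ` e \<inter> f ` e' = f ` (e \<inter> e')" using inj_on_image_Int[OF inj sub sub] that by simp
    moreover have "f ` e = f ` e' \<longleftrightarrow> e = e'" using inj' that by (auto dest: inj_onD)
    ultimately show ?thesis using that mem by (simp add: line_adj_def)
  qed
  ultimately show ?thesis by (simp add: rel_automorphism_def)
qed

text \<open>
  Every edge can be moved to an edge at one of finitely many vertices, and each of these vertices has
  finite degree.
\<close>
lemma finitely_many_orbits_line: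
  assumes G: "simple_graph V E" and deg: "\<And>v. finite (adj E `` {v})"
    and orb: "finitely_many_orbits V (adj E)"
  shows "finitely_many_orbits E (line_adj E)"
proof -
  obtain R where R: "R \<subseteq> V" "finite R"
    "\<And>v. v \<in> V \<Longrightarrow> \<exists>u\<in>R. \<exists>f. rel_automorphism V (adj E) f \<and> f u = v"
    using orb unfolding finitely_many_orbits_def by blast
  let ?R = "\<Union>u\<in>R. {e\<in>E. u \<in> e}"
  have "\<exists>e'\<in>?R. \<exists>g. rel_automorphism E (line_adj E) g \<and> g e' = e" if e: "e \<in> E" for e
  proof -
    obtain a b where ab: "a \<in> V" "b \<in> V" "e = {a, b}"
      using G e by (rule simple_graphE)
    obtain u f where u: "u \<in> R" and f: "rel_automorphism V (adj E) f" "f u = a"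
      using R(3)[OF ab(1)] by blast
    have "f ` V = V" using f(1) by (simp add: rel_automorphism_def bij_betw_def)
    then have "b \<in> f ` V" using ab(2) by simp
    then obtain w where w: "w \<in> V" "f w = b" by blast
    have "(f u, f w) \<in> adj E" using e ab f w by (simp add: adj_def)
    then have "{u, w} \<in> E"
      using f(1) u w R(1) unfolding rel_automorphism_def adj_def by blast
    then have "{u, w} \<in> ?R" using u by blast
    moreover have "f ` {u, w} = e" using f w ab by simp
    ultimately show ?thesis using rel_automorphism_line[OF G f(1)] by blast
  qed
  moreover have "finite ?R" using R(2) finite_line_degree(1)[OF G deg] by blast
  moreover have "?R \<subseteq> E" by blast
  ultimately show ?thesis unfolding finitely_many_orbits_def by blast
qed

lemma line_cluster_subset_bond_cluster:
  assumes G: "simple_graph V E" and "x \<in> V" "x \<in> e"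
    and f: "f \<in> reach (line_adj E) {e\<in>E. \<omega> e} {e}"
  shows "f \<subseteq> bond_cluster V E x \<omega>"
  using f
proof (induction rule: reach_induct)
  case (start e')
  have "x \<in> bond_cluster V E x \<omega>"
    unfolding bond_cluster_eq_reach[OF G] using \<open>x \<in> V\<close> by (intro reach_start) auto
  moreover obtain v where v: "e' = {x, v}" "(x, v) \<in> adj E"
    using edge_at[OF G, of e' x] start \<open>x \<in> e\<close> by auto
  moreover have "(x, v) \<in> adj {e\<in>E. \<omega> e}" using v start by (simp add: adj_def)
  moreover have "v \<in> V" using v adj_subset[OF G] by blast
  ultimately show ?case unfolding bond_cluster_eq_reach[OF G] by (blast intro: reach_step)
next
  case (step f g)
  then obtain u where u: "u \<in> f" "u \<in> g" by (auto simp: line_adj_def)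
  obtain v where v: "g = {u, v}" "(u, v) \<in> adj E"
    using edge_at[OF G, of g u] step.hyps u by auto
  moreover have "(u, v) \<in> adj {e\<in>E. \<omega> e}" using v step.hyps by (simp add: adj_def)
  moreover have "v \<in> V" using v adj_subset[OF G] by blast
  moreover have "u \<in> bond_cluster V E x \<omega>" using step.IH u by blast
  ultimately show ?case unfolding bond_cluster_eq_reach[OF G] by (blast intro: reach_step)
qed

lemma bond_cluster_subset_line_cluster:
  assumes G: "simple_graph V E" and e: "e \<in> E" "\<omega> e" "x \<in> e"
  shows "bond_cluster V E x \<omega> \<subseteq> insert x (\<Union> (reach (line_adj E) {e\<in>E. \<omega> e} {e}))"
  unfolding bond_cluster_eq_reach[OF G]
proof (rule reach_least)
  let ?K = "reach (line_adj E) {e\<in>E. \<omega> e} {e}"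
  have eK: "e \<in> ?K" using e by (intro reach_start) auto
  fix y z assume y: "y \<in> insert x (\<Union> ?K)" and yz: "(y, z) \<in> adj {e\<in>E. \<omega> e}"
  then obtain f where f: "f \<in> ?K" "y \<in> f" using eK e by blast
  have g: "{y, z} \<in> {e\<in>E. \<omega> e}" using yz by (simp add: adj_def)
  have "f \<in> E" using f(1) reach_subset[of "line_adj E" "{e\<in>E. \<omega> e}" "{e}"] by blast
  then have "f = {y, z} \<or> (f, {y, z}) \<in> line_adj E" using f g by (auto simp: line_adj_def)
  then have "{y, z} \<in> ?K" using f(1) g by (blast intro: reach_step)
  then show "z \<in> insert x (\<Union> ?K)" by blast
qed auto

lemma bond_cluster_isolated:
  assumes G: "simple_graph V E" and "\<And>e. e \<in> E \<Longrightarrow> x \<in> e \<Longrightarrow> \<not> \<omega> e"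
  shows "bond_cluster V E x \<omega> \<subseteq> {x}"
  unfolding bond_cluster_eq_reach[OF G]
  using assms(2) by (intro reach_least) (auto simp: adj_def)

text \<open>
  The bond cluster of \<open>x\<close> consists of \<open>x\<close> and of the endpoints of the open edges in the line graph
  cluster \<open>K\<close> of any open edge at \<open>x\<close>. Finitely many edges have finitely many endpoints, and finitely
  many vertices span only finitely many edges, even if degrees are infinite. So one of the two is
  finite iff the other is.
\<close>
lemma infinite_bond_cluster_iff:
  assumes G: "simple_graph V E" and x: "x \<in> V"
  shows "infinite (bond_cluster V E x \<omega>) \<longleftrightarrow>
    (\<exists>e\<in>{e\<in>E. x \<in> e}. infinite (reach (line_adj E) {e\<in>E. \<omega> e} {e}))"
proof
  assume inf: "infinite (bond_cluster V E x \<omega>)"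
  then obtain e where e: "e \<in> E" "x \<in> e" "\<omega> e"
    using bond_cluster_isolated[OF G, of x \<omega>] finite_subset[of _ "{x}"] by blast
  let ?K = "reach (line_adj E) {e\<in>E. \<omega> e} {e}"
  have "infinite ?K"
  proof
    assume "finite ?K"
    moreover have "finite f" if "f \<in> ?K" for f
    proof -
      have "f \<in> E" using that reach_subset[of "line_adj E" "{e\<in>E. \<omega> e}" "{e}"] by blast
      with G obtain a b where "f = {a, b}" by (rule simple_graphE)
      then show ?thesis by simp
    qed
    ultimately have "finite (insert x (\<Union> ?K))" by simp
    then show False
      using inf finite_subset[OF bond_cluster_subset_line_cluster[OF G e(1), of \<omega> x, OF e(3,2)]] by blast
  qed
  then show "\<exists>e\<in>{e\<in>E. x \<in> e}. infinite (reach (line_adj E) {e\<in>E. \<omega> e} {e})"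
    using e by blast
next
  assume "\<exists>e\<in>{e\<in>E. x \<in> e}. infinite (reach (line_adj E) {e\<in>E. \<omega> e} {e})"
  then obtain e where e: "x \<in> e" "infinite (reach (line_adj E) {e\<in>E. \<omega> e} {e})" by blast
  have "reach (line_adj E) {e\<in>E. \<omega> e} {e} \<subseteq> Pow (bond_cluster V E x \<omega>)"
    using line_cluster_subset_bond_cluster[OF G x e(1)] by blast
  then show "infinite (bond_cluster V E x \<omega>)"
    using e(2) finite_subset by (metis finite_Pow_iff)
qed

lemma ext_card_eq_top_iff [simp]: "ext_card A = top \<longleftrightarrow> infinite A"
  by (simp add: ext_card_def)

lemma ext_card_mono: "A \<subseteq> B \<Longrightarrow> ext_card A \<le> ext_card B"
  unfolding ext_card_eq_emeasure by (rule emeasure_mono) auto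

text \<open>
  Each edge of the cluster contributes at most two vertices. The sum over all edges at \<open>x\<close> avoids
  selecting an open one, which would depend on \<open>\<omega>\<close>.
\<close>
lemma ext_card_bond_cluster_le:
  assumes G: "simple_graph V E" and x: "x \<in> V" and fin: "finite {e\<in>E. x \<in> e}"
  shows "ext_card (bond_cluster V E x \<omega>)
    \<le> 1 + 2 * (\<Sum>e\<in>{e\<in>E. x \<in> e}. ext_card (reach (line_adj E) {e\<in>E. \<omega> e} {e}))"
    (is "_ \<le> 1 + 2 * sum ?k _")
proof (cases "\<exists>e\<in>E. x \<in> e \<and> \<omega> e")
  case False
  then have "ext_card (bond_cluster V E x \<omega>) \<le> ext_card {x}"
    by (intro ext_card_mono bond_cluster_isolated[OF G]) auto
  also have "\<dots> = 1" by (simp add: ext_card_def)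
  finally show ?thesis by (intro add_increasing2) simp_all
next
  case True
  then obtain e where e: "e \<in> E" "x \<in> e" "\<omega> e" by blast
  let ?K = "reach (line_adj E) {e\<in>E. \<omega> e} {e}"
  have "ext_card (bond_cluster V E x \<omega>) \<le> 1 + 2 * ext_card ?K"
  proof (cases "finite ?K")
    case True
    have card: "card f \<le> 2 \<and> finite f" if "f \<in> ?K" for f
    proof -
      have "f \<in> E" using that reach_subset[of "line_adj E" "{e\<in>E. \<omega> e}" "{e}"] by blast
      with G obtain a b where "f = {a, b}" by (rule simple_graphE)
      then show ?thesis by (simp add: card_insert_if)
    qed
    have fU: "finite (\<Union> ?K)" using True card by blast
    have "card (insert x (\<Union> ?K)) \<le> Suc (card (\<Union> ?K))" using fU by (simp add: card_insert_if)
    also have "\<dots> \<le> Suc (\<Sum>f\<in>?K. card f)"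
      using card_Union_le_sum_card[of ?K] by simp
    also have "\<dots> \<le> Suc (\<Sum>f\<in>?K. 2)" using card by (intro Suc_le_mono[THEN iffD2] sum_mono) blast
    finally have "card (insert x (\<Union> ?K)) \<le> 1 + 2 * card ?K" by simp
    then have "ext_card (insert x (\<Union> ?K)) \<le> of_nat (1 + 2 * card ?K)"
      using fU by (simp only: ext_card_def finite_insert if_True of_nat_le_iff)
    also have "\<dots> = 1 + 2 * ext_card ?K" using True by (simp add: ext_card_def)
    finally show ?thesis
      using ext_card_mono[OF bond_cluster_subset_line_cluster[OF G e(1), of \<omega> x, OF e(3,2)]] by (rule order_trans[rotated])
  qed (simp add: ext_card_def ennreal_mult_top)
  also have "ext_card ?K \<le> sum ?k {e\<in>E. x \<in> e}"
    using e fin by (intro member_le_sum) auto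
  finally show ?thesis by (simp add: add_left_mono mult_left_mono)
qed

section \<open>Equality of the critical values\<close>
text \<open>
  The parameter 0 ensures that the supremum defining \<open>p\<^sub>T\<close> is over a nonempty set. If \<open>p\<^sub>T\<close> were
  smaller than \<open>p\<^sub>H\<close>, infinite clusters would have probability 0 at some \<open>h > p\<^sub>T\<close>; then any \<open>p\<close> strictly between
  \<open>p\<^sub>T\<close> and \<open>h\<close> has infinite expectation and contradicts \<open>sharp\<close>.
\<close>
lemma crit_T_eq_crit_H:
  assumes zero: "(\<integral>\<^sup>+ \<omega>. ext_card (C \<omega>) \<partial>P 0) < \<infinity>"
    and sharp: "\<And>p p'. 0 \<le> p \<Longrightarrow> p < p' \<Longrightarrow> p' \<le> 1 \<Longrightarrow> (\<integral>\<^sup>+ \<omega>. ext_card (C \<omega>) \<partial>P p) = \<infinity> \<Longrightarrow>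
      0 < measure (P p') {\<omega> \<in> space (P p'). ext_card (C \<omega>) = \<infinity>}"
  shows "crit_T P C = crit_H P C"
proof -
  define T where "T = {p \<in> {0..1}. (\<integral>\<^sup>+ \<omega>. ext_card (C \<omega>) \<partial>P p) < \<infinity>}"
  define H where "H = {p \<in> {0..1}. measure (P p) {\<omega> \<in> space (P p). ext_card (C \<omega>) = \<infinity>} = 0}"
  have "T \<subseteq> H"
  proof
    fix p assume p: "p \<in> T"
    let ?X = "{\<omega> \<in> space (P p). ext_card (C \<omega>) = \<infinity>}"
    \<comment> \<open>a set that is not measurable has \<open>measure\<close> 0 by convention\<close>
    have "measure (P p) ?X = 0"
    proof (cases "?X \<in> sets (P p)")
      case True
      then have "\<infinity> * emeasure (P p) ?X = (\<integral>\<^sup>+ \<omega>. \<infinity> * indicator ?X \<omega> \<partial>P p)"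
        by (rule nn_integral_cmult_indicator[symmetric])
      also have "\<dots> \<le> (\<integral>\<^sup>+ \<omega>. ext_card (C \<omega>) \<partial>P p)"
        by (rule nn_integral_mono) (auto simp: indicator_def ext_card_def)
      also have "\<dots> < \<infinity>" using p by (simp add: T_def)
      finally have "emeasure (P p) ?X = 0" by (auto simp: ennreal_top_mult split: if_splits)
      then show ?thesis by (simp add: measure_def)
    qed (simp add: measure_notin_sets)
    then show "p \<in> H" using p by (simp add: T_def H_def)
  qed
  have T0: "0 \<in> T" using zero by (simp add: T_def)
  have bdd: "bdd_above T" "bdd_above H" by (auto simp: T_def H_def intro: bdd_aboveI[of _ 1])
  have "Sup T \<le> Sup H" using T0 \<open>T \<subseteq> H\<close> bdd by (intro cSup_subset_mono) auto
  moreover have "Sup H \<le> Sup T"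
  proof (rule cSup_least)
    show "H \<noteq> {}" using T0 \<open>T \<subseteq> H\<close> by auto
    fix h assume h: "h \<in> H"
    show "h \<le> Sup T"
    proof (rule ccontr)
      assume "\<not> h \<le> Sup T"
      then obtain p where p: "Sup T < p" "p < h" using dense by (auto simp: not_le)
      have "0 \<le> Sup T" using cSup_upper[OF T0 bdd(1)] .
      have "p \<notin> T" using cSup_upper[OF _ bdd(1), of p] p by auto
      then have "(\<integral>\<^sup>+ \<omega>. ext_card (C \<omega>) \<partial>P p) = \<infinity>"
        using p h \<open>0 \<le> Sup T\<close> by (auto simp: T_def H_def not_less top_unique)
      then have "0 < measure (P h) {\<omega> \<in> space (P h). ext_card (C \<omega>) = \<infinity>}"
        using p h \<open>0 \<le> Sup T\<close> by (intro sharp[of p h]) (auto simp: H_def)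
      then show False using h by (simp add: H_def)
    qed
  qed
  ultimately show ?thesis unfolding crit_T_def crit_H_def T_def H_def by simp
qed

text \<open>
  With a vertex of infinite degree, which the finiteness of the number of orbits allows, there is percolation
  at every positive parameter, and both critical values are 0.
\<close>
lemma site_pT_eq_pH:
  assumes G: "simple_graph V E" "countable V" "connected_graph V E" and q: "quasi_transitive V E"
    and x: "x \<in> V"
  shows "site_pT V E x = site_pH V E x"
proof -
  interpret percolation_graph V "adj E" by (rule percolation_graph_adj[OF G])
  have C: "site_cluster V E x = cluster x"
    by (simp add: fun_eq_iff site_cluster_eq_reach[OF G(1)] cluster_def)
  show ?thesis
    unfolding site_pT_def site_pH_def C
  proof (rule crit_T_eq_crit_H)
    have "AE \<omega> in bernoulli_product V 0. ext_card (cluster x \<omega>) \<le> 0"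
      using AE_bernoulli_product_0[OF G(2)]
    proof (rule AE_mp, intro AE_I2 impI)
      fix \<omega> assume "\<forall>v\<in>V. \<not> \<omega> v"
      then have "cluster x \<omega> = {}"
        using reach_subset[of "adj E" "{v\<in>V. \<omega> v}" "{x}"] unfolding cluster_def by blast
      then show "ext_card (cluster x \<omega>) \<le> 0" by (simp add: ext_card_def)
    qed
    then have "(\<integral>\<^sup>+ \<omega>. ext_card (cluster x \<omega>) \<partial>bernoulli_product V 0)
        \<le> (\<integral>\<^sup>+ \<omega>. 0 \<partial>bernoulli_product V 0)" by (rule nn_integral_mono_AE)
    then show "(\<integral>\<^sup>+ \<omega>. ext_card (cluster x \<omega>) \<partial>bernoulli_product V 0) < \<infinity>" by simp
  next
    fix p p' :: real
    assume p: "0 \<le> p" "p < p'" "p' \<le> 1"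
      and inf: "(\<integral>\<^sup>+ \<omega>. ext_card (cluster x \<omega>) \<partial>bernoulli_product V p) = \<infinity>"
    show "0 < measure (bernoulli_product V p')
        {\<omega> \<in> space (bernoulli_product V p'). ext_card (cluster x \<omega>) = \<infinity>}"
    proof (cases "\<forall>v. finite (adj E `` {v})")
      case True
      then show ?thesis
        using infinite_cluster_if_infinite_expectation[OF x _ finitely_many_orbits_adj[OF q] p inf] by simp
    next
      case False
      then obtain y where "infinite (adj E `` {y})" by blast
      then show ?thesis using p by (intro infinite_cluster_if_infinite_degree[OF x]) auto
    qed
  qed
qed

text \<open>
  If the expected size of the bond cluster of \<open>x\<close> is infinite, so is that of the line graph cluster of
  one of the finitely many edges at \<open>x\<close>, and site percolation on the line graph applies to this edge.
  With a vertex of infinite degree, it applies to any edge at \<open>x\<close>.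
\<close>
lemma bond_pT_eq_pH:
  assumes G: "simple_graph V E" "countable V" "connected_graph V E" and q: "quasi_transitive V E"
    and x: "x \<in> V" and inf: "infinite V"
  shows "bond_pT V E x = bond_pH V E x"
proof -
  interpret L: percolation_graph E "line_adj E" by (rule percolation_graph_line[OF G])
  let ?Ex = "{e\<in>E. x \<in> e}" and ?C = "bond_cluster V E x"
  have bound: "0 < measure (bernoulli_product E p)
        {\<omega> \<in> space (bernoulli_product E p). ext_card (?C \<omega>) = \<infinity>}"
    if p: "0 \<le> p" "p \<le> 1" and e: "e \<in> ?Ex"
      and pos: "0 < measure (bernoulli_product E p)
        {\<omega> \<in> space (bernoulli_product E p). ext_card (L.cluster e \<omega>) = \<infinity>}" for p e
  proof -
    let ?M = "bernoulli_product E p"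
    let ?X = "\<lambda>e. {\<omega> \<in> space ?M. ext_card (L.cluster e \<omega>) = \<infinity>}"
    interpret M: prob_space ?M by (rule prob_space_bernoulli_product)
    have meas: "?X e \<in> sets ?M" for e
      using L.measurable_ext_card_cluster[OF p] by measurable
    have "{\<omega> \<in> space ?M. ext_card (?C \<omega>) = \<infinity>} = (\<Union>e\<in>?Ex. ?X e)"
      by (auto simp: infinite_bond_cluster_iff[OF G(1) x] L.cluster_def)
    moreover have "(\<Union>e\<in>?Ex. ?X e) \<in> sets ?M"
      using meas countable_subset[OF _ L.countable] by (intro sets.countable_UN') auto
    ultimately have "measure ?M (?X e) \<le> measure ?M {\<omega> \<in> space ?M. ext_card (?C \<omega>) = \<infinity>}"
      using e by (intro M.finite_measure_mono) auto
    then show ?thesis using pos by linarith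
  qed
  show ?thesis
    unfolding bond_pT_def bond_pH_def
  proof (rule crit_T_eq_crit_H)
    have "AE \<omega> in bernoulli_product E 0. ext_card (?C \<omega>) \<le> 1"
      using AE_bernoulli_product_0[OF L.countable]
    proof (rule AE_mp, intro AE_I2 impI)
      fix \<omega> assume "\<forall>e\<in>E. \<not> \<omega> e"
      then have "ext_card (?C \<omega>) \<le> ext_card {x}"
        by (intro ext_card_mono bond_cluster_isolated[OF G(1)]) auto
      then show "ext_card (?C \<omega>) \<le> 1" by (simp add: ext_card_def)
    qed
    then have "(\<integral>\<^sup>+ \<omega>. ext_card (?C \<omega>) \<partial>bernoulli_product E 0)
        \<le> (\<integral>\<^sup>+ \<omega>. 1 \<partial>bernoulli_product E 0)" by (rule nn_integral_mono_AE)
    also have "\<dots> = 1"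
      using prob_space.emeasure_space_1[OF prob_space_bernoulli_product] by simp
    finally show "(\<integral>\<^sup>+ \<omega>. ext_card (?C \<omega>) \<partial>bernoulli_product E 0) < \<infinity>"
      by (simp add: order_le_less_trans)
  next
    fix p p' :: real
    assume p: "0 \<le> p" "p < p'" "p' \<le> 1"
      and inf: "(\<integral>\<^sup>+ \<omega>. ext_card (?C \<omega>) \<partial>bernoulli_product E p) = \<infinity>"
    let ?M = "bernoulli_product E p"
    show "0 < measure (bernoulli_product E p')
        {\<omega> \<in> space (bernoulli_product E p'). ext_card (?C \<omega>) = \<infinity>}"
    proof (cases "\<forall>v. finite (adj E `` {v})")
      case True
      then have deg: "\<And>v. finite (adj E `` {v})" by blast
      note fin = finite_line_degree[OF G(1) deg]
      interpret M: prob_space ?M by (rule prob_space_bernoulli_product)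
      have meas: "(\<lambda>\<omega>. ext_card (L.cluster e \<omega>)) \<in> borel_measurable ?M" for e
        using p by (intro L.measurable_ext_card_cluster) auto
      have "(\<integral>\<^sup>+ \<omega>. ext_card (?C \<omega>) \<partial>?M)
          \<le> (\<integral>\<^sup>+ \<omega>. 1 + 2 * (\<Sum>e\<in>?Ex. ext_card (L.cluster e \<omega>)) \<partial>?M)"
        unfolding L.cluster_def by (intro nn_integral_mono ext_card_bond_cluster_le[OF G(1) x fin(1)])
      also have "\<dots> = 1 + 2 * (\<Sum>e\<in>?Ex. \<integral>\<^sup>+ \<omega>. ext_card (L.cluster e \<omega>) \<partial>?M)"
        using meas by (simp add: nn_integral_add nn_integral_cmult nn_integral_sum M.emeasure_space_1)
      finally have "(\<Sum>e\<in>?Ex. \<integral>\<^sup>+ \<omega>. ext_card (L.cluster e \<omega>) \<partial>?M) = \<infinity>"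
        using inf by (auto simp: top_unique ennreal_mult_eq_top_iff)
      then obtain e where e: "e \<in> ?Ex" "(\<integral>\<^sup>+ \<omega>. ext_card (L.cluster e \<omega>) \<partial>?M) = \<infinity>"
        by (auto simp: fin(1))
      have "0 < measure (bernoulli_product E p')
          {\<omega> \<in> space (bernoulli_product E p'). ext_card (L.cluster e \<omega>) = \<infinity>}"
      proof (rule L.infinite_cluster_if_infinite_expectation[OF _ fin(2) _ p e(2)])
        show "e \<in> E" using e by simp
        show "finitely_many_orbits E (line_adj E)"
          by (rule finitely_many_orbits_line[OF G(1) deg finitely_many_orbits_adj[OF q]])
      qed
      then show ?thesis using p e(1) by (intro bound) auto
    next
      case False
      then obtain y where "infinite (adj E `` {y})" by blast
      from infinite_line_degree[OF this] obtain f where f: "infinite (line_adj E `` {f})" ..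
      obtain v where v: "v \<in> V" "v \<noteq> x"
        using \<open>infinite V\<close> finite_subset[of V "{x}"] by blast
      have "(x, v) \<in> (adj E)\<^sup>*" by (rule connected_graph_adj[OF G(3) x v(1)])
      then obtain z where "(x, z) \<in> adj E" using v(2) by (auto elim: converse_rtranclE)
      then have e: "{x, z} \<in> ?Ex" by (simp add: adj_def)
      have "0 < measure (bernoulli_product E p')
          {\<omega> \<in> space (bernoulli_product E p'). ext_card (L.cluster {x, z} \<omega>) = \<infinity>}"
        using p e f by (intro L.infinite_cluster_if_infinite_degree) auto
      then show ?thesis using p e by (intro bound) auto
    qed
  qed
qed

theorem theorem2:
  fixes V :: "'v set" and E :: "'v set set" and x :: 'v
  assumes "simple_graph V E"
    and "infinite V" and "countable V"
    and "connected_graph V E"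
    and "quasi_transitive V E"
    and "x \<in> V"
  shows "bond_pT V E x = bond_pH V E x \<and> site_pT V E x = site_pH V E x"
  using bond_pT_eq_pH[OF assms(1,3,4,5,6,2)] site_pT_eq_pH[OF assms(1,3,4,5,6)] by (rule conjI)

end
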